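(* If $(M,F)$ is a complex Berwald space of complex dimension $2$, then $\mathbf I_{|j}=0$ for $j=1,2$.
   Context: $M$ is a complex manifold with $\dim_{\mathbb C}M=2$; $T'M$ is its holomorphic tangent bundle with local coordinates $(z^k,\eta^k)_{k=1,2}$; $\widetilde{T'M}$ is $T'M$ minus the zero section. A complex Finsler space $(M,F)$: $F:T'M\to[0,\infty)$ is continuous, $L:=F^2$ is smooth on $\widetilde{T'M}$, $F(z,\eta)=0$ iff $\eta=0$, $F(z,\lambda\eta)=|\lambda|F(z,\eta)$ for all $\lambda\in\mathbb C$, and the Hermitian matrix $g_{i\bar j}:=\partial^2L/\partial\eta^i\partial\bar\eta^j$ is positive definite on $\widetilde{T'M}$. Repeated indices are summed over $\{1,2\}$; everything lives on $\widetilde{T'M}$; bars on indices denote conjugation. $(g^{\bar m i})$ is the inverse matrix: $g^{\bar m i}g_{j\bar m}=\delta^i_j$. Chern–Finsler connection: $\dot\partial_k:=\partial/\partial\eta^k$, $\dot\partial_{\bar k}:=\partial/\partial\bar\eta^k$, $N^k_j:=g^{\bar mk}\frac{\partial g_{l\bar m}}{\partial z^j}\eta^l$, $\delta_k:=\frac{\partial}{\partial z^k}-N^j_k\dot\partial_j$, $L^i_{jk}:=g^{\bar li}\delta_kg_{j\bar l}$, $C^i_{jk}:=g^{\bar li}\dot\partial_kg_{j\bar l}$. With $T^i_{jk}:=L^i_{jk}-L^i_{kj}$, the space is Kähler if $T^i_{jk}\eta^j=0$ (known to be equivalent to $T^i_{jk}=0$), and it is a complex Berwald space if it is Kähler and $L^i_{jk}=L^i_{jk}(z)$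 does not depend on $\eta$. In a fixed local chart: $l^i:=\eta^i/F$, $l_i:=\frac1Fg_{i\bar j}\bar\eta^j$, $g:=\det(g_{i\bar j})$, $m^1:=-l_2/\sqrt g$, $m^2:=l_1/\sqrt g$, $m_1:=-\sqrt g\,l^2$, $m_2:=\sqrt g\,l^1$, $m^{\bar s}:=\overline{m^s}$; $B:=m_hm^km^jC^h_{jk}$; and the vertical curvature invariant is $\mathbf I:=-m^{\bar s}\dot\partial_{\bar s}B-\frac12B\bar B$, a function on $\widetilde{T'M}$ independent of the chart. $\mathbf I_{|j}:=\delta_j\mathbf I$. *)

theory Defs
  imports "HOL-Analysis.Analysis"
begin

section \<open>Complex manifolds\<close>

definition holomorphic_map_on :: "(complex^'n \<Rightarrow> complex^'m) \<Rightarrow> (complex^'n) set \<Rightarrow> bool" where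
  "holomorphic_map_on f S \<longleftrightarrow>
     (\<forall>z\<in>S. \<exists>D. (f has_derivative D) (at z) \<and> (\<forall>a v. D (a *s v) = a *s D v))"

type_synonym ('a, 'n) chart = "'a set \<times> ('a \<Rightarrow> complex^'n)"

definition is_chart :: "'a topology \<Rightarrow> ('a, 'n::finite) chart \<Rightarrow> bool" where
  "is_chart X c \<longleftrightarrow> openin X (fst c) \<and> open (snd c ` fst c) \<and>
     homeomorphic_map (subtopology X (fst c)) (top_of_set (snd c ` fst c)) (snd c)"

text \<open>The coordinate change from \<open>c\<close> to \<open>d\<close>; only its values on
  \<open>snd c ` (fst c \<inter> fst d)\<close> are meaningful.\<close>

definition transition :: "('a, 'n) chart \<Rightarrow> ('a, 'n) chart \<Rightarrow> complex^'n \<Rightarrow> complex^'n" where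
  "transition c d = snd d \<circ> inv_into (fst c) (snd c)"

text \<open>The atlas is not required to be maximal; the complex dimension is \<open>CARD('n)\<close>.\<close>

definition complex_manifold :: "'a topology \<Rightarrow> ('a, 'n::finite) chart set \<Rightarrow> bool" where
  "complex_manifold X A \<longleftrightarrow>
     Hausdorff_space X \<and>
     (\<exists>\<B>. countable \<B> \<and> (\<forall>V\<in>\<B>. openin X V) \<and>
        (\<forall>U x. openin X U \<and> x \<in> U \<longrightarrow> (\<exists>V\<in>\<B>. x \<in> V \<and> V \<subseteq> U))) \<and>
     (\<forall>c\<in>A. is_chart X c) \<and>
     (\<Union>c\<in>A. fst c) = topspace X \<and>
     (\<forall>c\<in>A. \<forall>d\<in>A. holomorphic_map_on (transition c d) (snd c ` (fst c \<inter> fst d)))"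

section \<open>The holomorphic tangent bundle\<close>

text \<open>A holomorphic tangent vector at \<open>p\<close> is given by its components \<open>v c\<close> in every chart
  \<open>c\<close> around \<open>p\<close>, subject to the transformation law
  \<open>v d = (\<partial>z\<^sub>d / \<partial>z\<^sub>c) (v c)\<close>.  For charts not containing \<open>p\<close> the value is
  normalised to \<open>0\<close>, so that equal vectors are equal as functions.\<close>

type_synonym ('a, 'n) tvec = "'a \<times> (('a, 'n) chart \<Rightarrow> complex^'n)"

definition tangent_bundle :: "'a topology \<Rightarrow> ('a, 'n::finite) chart set \<Rightarrow> ('a, 'n) tvec set" where
  "tangent_bundle X A = {(p, v). p \<in> topspace X \<and>
     (\<forall>c\<in>A. \<forall>d\<in>A. p \<in> fst c \<longrightarrow> p \<in> fst d \<longrightarrow>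
        v d = frechet_derivative (transition c d) (at (snd c p)) (v c)) \<and>
     (\<forall>c. c \<notin> A \<or> p \<notin> fst c \<longrightarrow> v c = 0)}"

text \<open>The coordinates \<open>(z, \<eta>)\<close> on the tangent bundle induced by a chart.\<close>

definition tcoord :: "('a, 'n) chart \<Rightarrow> ('a, 'n) tvec \<Rightarrow> (complex^'n) \<times> (complex^'n)" where
  "tcoord c w = (snd c (fst w), snd w c)"

text \<open>On a complex manifold, \<open>tcoord c\<close> is a bijection from the part of the bundle over
  \<open>fst c\<close> onto \<open>(snd c ` fst c) \<times> UNIV\<close>; \<open>in_coords\<close> is only used on that set.\<close>

definition in_coords :: "'a topology \<Rightarrow> ('a, 'n::finite) chart set \<Rightarrow> (('a, 'n) tvec \<Rightarrow> real) \<Rightarrow>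
    ('a, 'n) chart \<Rightarrow> (complex^'n) \<times> (complex^'n) \<Rightarrow> real" where
  "in_coords X A F c = F \<circ> inv_into {w \<in> tangent_bundle X A. fst w \<in> fst c} (tcoord c)"

text \<open>Coordinate domain of the tangent bundle without its zero section.\<close>

definition slit_dom :: "('a, 'n) chart \<Rightarrow> ((complex^'n) \<times> (complex^'n)) set" where
  "slit_dom c = (snd c ` fst c) \<times> (- {0})"

section \<open>Smoothness and Wirtinger derivatives\<close>

primrec Ck_on :: "nat \<Rightarrow> ('a::real_normed_vector) set \<Rightarrow> ('a \<Rightarrow> 'b::real_normed_vector) \<Rightarrow> bool" where
  "Ck_on 0 S f \<longleftrightarrow> continuous_on S f"
| "Ck_on (Suc k) S f \<longleftrightarrow> (\<forall>x\<in>S. f differentiable (at x)) \<and>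
     (\<forall>v. Ck_on k S (\<lambda>x. frechet_derivative f (at x) v))"

definition smooth_on :: "('a::real_normed_vector) set \<Rightarrow> ('a \<Rightarrow> 'b::real_normed_vector) \<Rightarrow> bool" where
  "smooth_on S f \<longleftrightarrow> (\<forall>k. Ck_on k S f)"

text \<open>With \<open>z\<^sup>k = x\<^sup>k + \<i> y\<^sup>k\<close>, the operators
  \<open>\<partial>/\<partial>z\<^sup>k = (\<partial>/\<partial>x\<^sup>k - \<i> \<partial>/\<partial>y\<^sup>k) / 2\<close> etc., for functions of
  \<open>(z, \<eta>)\<close> that are differentiable in the real sense.\<close>

type_synonym 'n cfun = "(complex^'n) \<times> (complex^'n) \<Rightarrow> complex"

definition d_z :: "'n::finite \<Rightarrow> 'n cfun \<Rightarrow> 'n cfun" where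
  "d_z k f p = (frechet_derivative f (at p) (axis k 1, 0)
      - \<i> * frechet_derivative f (at p) (axis k \<i>, 0)) / 2"

definition d_eta :: "'n::finite \<Rightarrow> 'n cfun \<Rightarrow> 'n cfun" where
  "d_eta k f p = (frechet_derivative f (at p) (0, axis k 1)
      - \<i> * frechet_derivative f (at p) (0, axis k \<i>)) / 2"

definition d_etabar :: "'n::finite \<Rightarrow> 'n cfun \<Rightarrow> 'n cfun" where
  "d_etabar k f p = (frechet_derivative f (at p) (0, axis k 1)
      + \<i> * frechet_derivative f (at p) (0, axis k \<i>)) / 2"

section \<open>Complex Finsler spaces\<close>

text \<open>In the local formulas below, \<open>F :: (complex^'n) \<times> (complex^'n) \<Rightarrow> real\<close> is the expression of the
  Finsler function in the coordinates \<open>(z, \<eta>)\<close> of a fixed chart, that is,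
  \<open>in_coords X A F c\<close> for a Finsler function on the tangent bundle.\<close>

definition Lfun :: "((complex^'n) \<times> (complex^'n) \<Rightarrow> real) \<Rightarrow> 'n::finite cfun" where
  "Lfun F p = of_real ((F p)\<^sup>2)"

text \<open>Row \<open>i\<close>, column \<open>j\<close> of \<open>g_low\<close> is \<open>g\<close> with lower indices \<open>i, j-bar\<close>; row
  \<open>m\<close>, column \<open>i\<close> of \<open>g_up\<close> is \<open>g\<close> with upper indices \<open>m-bar, i\<close>.\<close>

definition g_low :: "((complex^'n) \<times> (complex^'n) \<Rightarrow> real) \<Rightarrow> (complex^'n) \<times> (complex^'n) \<Rightarrow>
    complex^'n^('n::finite)" where
  "g_low F p = (\<chi> i j. d_eta i (d_etabar j (Lfun F)) p)"

definition g_up :: "((complex^'n) \<times> (complex^'n) \<Rightarrow> real) \<Rightarrow> (complex^'n) \<times> (complex^'n) \<Rightarrow>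
    complex^'n^('n::finite)" where
  "g_up F p = matrix_inv (g_low F p)"

definition positive_definite :: "complex^'n^('n::finite) \<Rightarrow> bool" where
  "positive_definite H \<longleftrightarrow> (\<forall>i j. H $ j $ i = cnj (H $ i $ j)) \<and>
     (\<forall>v. v \<noteq> 0 \<longrightarrow> 0 < Re (\<Sum>i\<in>UNIV. \<Sum>j\<in>UNIV. H $ i $ j * v $ i * cnj (v $ j)))"

text \<open>The topology and the smooth structure of the tangent bundle are those induced by the
  charts \<open>tcoord c\<close>, so continuity and smoothness are tested in these coordinates.\<close>

definition complex_finsler_space ::
    "'a topology \<Rightarrow> ('a, 'n::finite) chart set \<Rightarrow> (('a, 'n) tvec \<Rightarrow> real) \<Rightarrow> bool" where
  "complex_finsler_space X A F \<longleftrightarrow>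
     complex_manifold X A \<and>
     (\<forall>w\<in>tangent_bundle X A. 0 \<le> F w) \<and>
     (\<forall>c\<in>A. continuous_on ((snd c ` fst c) \<times> UNIV) (in_coords X A F c)) \<and>
     (\<forall>c\<in>A. smooth_on (slit_dom c) (\<lambda>p. (in_coords X A F c p)\<^sup>2)) \<and>
     (\<forall>(p, v)\<in>tangent_bundle X A. F (p, v) = 0 \<longleftrightarrow> v = (\<lambda>c. 0)) \<and>
     (\<forall>(p, v)\<in>tangent_bundle X A. \<forall>a. F (p, \<lambda>c. a *s v c) = cmod a * F (p, v)) \<and>
     (\<forall>c\<in>A. \<forall>p\<in>slit_dom c. positive_definite (g_low (in_coords X A F c) p))"

section \<open>The Chern-Finsler connection\<close>

definition N_conn :: "((complex^'n) \<times> (complex^'n) \<Rightarrow> real) \<Rightarrow> 'n \<Rightarrow> 'n \<Rightarrow> 'n::finite cfun" where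
  "N_conn F k j p =
     (\<Sum>m\<in>UNIV. \<Sum>l\<in>UNIV. g_up F p $ m $ k * d_z j (\<lambda>q. g_low F q $ l $ m) p * snd p $ l)"

definition delta :: "((complex^'n) \<times> (complex^'n) \<Rightarrow> real) \<Rightarrow> 'n \<Rightarrow> 'n cfun \<Rightarrow> 'n::finite cfun" where
  "delta F k f p = d_z k f p - (\<Sum>j\<in>UNIV. N_conn F j k p * d_eta j f p)"

definition L_conn :: "((complex^'n) \<times> (complex^'n) \<Rightarrow> real) \<Rightarrow> 'n \<Rightarrow> 'n \<Rightarrow> 'n \<Rightarrow> 'n::finite cfun" where
  "L_conn F i j k p = (\<Sum>l\<in>UNIV. g_up F p $ l $ i * delta F k (\<lambda>q. g_low F q $ j $ l) p)"

definition C_conn :: "((complex^'n) \<times> (complex^'n) \<Rightarrow> real) \<Rightarrow> 'n \<Rightarrow> 'n \<Rightarrow> 'n \<Rightarrow> 'n::finite cfun" where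
  "C_conn F i j k p = (\<Sum>l\<in>UNIV. g_up F p $ l $ i * d_eta k (\<lambda>q. g_low F q $ j $ l) p)"

definition T_tors :: "((complex^'n) \<times> (complex^'n) \<Rightarrow> real) \<Rightarrow> 'n \<Rightarrow> 'n \<Rightarrow> 'n \<Rightarrow> 'n::finite cfun" where
  "T_tors F i j k p = L_conn F i j k p - L_conn F i k j p"

definition kaehler_finsler_space ::
    "'a topology \<Rightarrow> ('a, 'n::finite) chart set \<Rightarrow> (('a, 'n) tvec \<Rightarrow> real) \<Rightarrow> bool" where
  "kaehler_finsler_space X A F \<longleftrightarrow> complex_finsler_space X A F \<and>
     (\<forall>c\<in>A. \<forall>p\<in>slit_dom c. \<forall>i k.
        (\<Sum>j\<in>UNIV. T_tors (in_coords X A F c) i j k p * snd p $ j) = 0)"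

definition complex_berwald_space ::
    "'a topology \<Rightarrow> ('a, 'n::finite) chart set \<Rightarrow> (('a, 'n) tvec \<Rightarrow> real) \<Rightarrow> bool" where
  "complex_berwald_space X A F \<longleftrightarrow> kaehler_finsler_space X A F \<and>
     (\<forall>c\<in>A. \<forall>i j k. \<exists>\<Gamma>. \<forall>(z, \<eta>)\<in>slit_dom c. L_conn (in_coords X A F c) i j k (z, \<eta>) = \<Gamma> z)"

section \<open>The vertical curvature invariant in dimension two\<close>

definition l_up :: "((complex^2) \<times> (complex^2) \<Rightarrow> real) \<Rightarrow> 2 \<Rightarrow> 2 cfun" where
  "l_up F i p = snd p $ i / of_real (F p)"

definition l_low :: "((complex^2) \<times> (complex^2) \<Rightarrow> real) \<Rightarrow> 2 \<Rightarrow> 2 cfun" where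
  "l_low F i p = (\<Sum>j\<in>UNIV. g_low F p $ i $ j * cnj (snd p $ j)) / of_real (F p)"

text \<open>The determinant of \<open>g\<close> is real and positive, so the principal root is the positive
  one.\<close>

definition sqrt_g :: "((complex^2) \<times> (complex^2) \<Rightarrow> real) \<Rightarrow> 2 cfun" where
  "sqrt_g F p = csqrt (det (g_low F p))"

definition m_up :: "((complex^2) \<times> (complex^2) \<Rightarrow> real) \<Rightarrow> 2 \<Rightarrow> 2 cfun" where
  "m_up F i p = (if i = 1 then - l_low F 2 p / sqrt_g F p else l_low F 1 p / sqrt_g F p)"

definition m_low :: "((complex^2) \<times> (complex^2) \<Rightarrow> real) \<Rightarrow> 2 \<Rightarrow> 2 cfun" where
  "m_low F i p = (if i = 1 then - sqrt_g F p * l_up F 2 p else sqrt_g F p * l_up F 1 p)"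

definition B_inv :: "((complex^2) \<times> (complex^2) \<Rightarrow> real) \<Rightarrow> 2 cfun" where
  "B_inv F p = (\<Sum>h\<in>UNIV. \<Sum>k\<in>UNIV. \<Sum>j\<in>UNIV.
      m_low F h p * m_up F k p * m_up F j p * C_conn F h j k p)"

definition I_inv :: "((complex^2) \<times> (complex^2) \<Rightarrow> real) \<Rightarrow> 2 cfun" where
  "I_inv F p = - (\<Sum>s\<in>UNIV. cnj (m_up F s p) * d_etabar s (B_inv F) p)
      - B_inv F p * cnj (B_inv F p) / 2"

end

theory Submission
  imports Defs
begin

text \<open>Write \<open>\<Gamma>\<close> for the connection coefficients, which do not depend on \<open>\<eta>\<close>, and \<open>\<tau>\<^sub>k\<close> for the
  trace \<open>\<Gamma>\<^sup>i\<^sub>i\<^sub>k\<close>. By definition \<open>\<delta>\<^sub>k\<close> acts on the rows of \<open>g\<close> through \<open>\<Gamma>\<close>. Homogeneity gives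
  \<open>N\<^sup>i\<^sub>k = \<Gamma>\<^sup>i\<^sub>j\<^sub>k \<eta>\<^sup>j\<close>, which is holomorphic in \<open>\<eta>\<close>, so that \<open>\<delta>\<^sub>k\<close> commutes with the
  \<open>\<eta>\<close>-conjugate derivatives, \<open>\<delta>\<^sub>k F = 0\<close>, and \<open>\<delta>\<^sub>k \<surd>g = \<tau>\<^sub>k \<surd>g / 2\<close>. Hence the frame
  vectors are parallel up to the weights \<open>\<plusminus> \<tau>\<^sub>k / 2\<close> contributed by \<open>\<surd>g\<close>:
  \<open>\<delta>\<^sub>k\<close> multiplies \<open>B\<close> by \<open>\<tau>\<^sub>k / 2\<close>, and both \<open>cnj B\<close> and \<open>cnj m\<close> by
  \<open>- \<tau>\<^sub>k / 2\<close>. Both terms of the invariant have total weight \<open>0\<close>.\<close>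

section \<open>Smooth functions on open sets\<close>

lemma Ck_on_cong:
  assumes "open S" "\<And>x. x \<in> S \<Longrightarrow> f x = g x" "Ck_on k S f"
  shows "Ck_on k S g"
  using assms(2,3)
proof (induction k arbitrary: f g)
  case 0
  then show ?case using continuous_on_cong[of S S f g] by simp
next
  case (Suc k)
  have d: "f differentiable (at x)" if "x \<in> S" for x
    using Suc.prems that by simp
  have e: "frechet_derivative f (at x) = frechet_derivative g (at x)" if "x \<in> S" for x
    using frechet_derivative_transform_within_open[OF d \<open>open S\<close>] Suc.prems that by blast
  have "g differentiable (at x)" if xS: "x \<in> S" for x
  proof -
    obtain D where "(f has_derivative D) (at x)"
      using d[OF xS] unfolding differentiable_def by blast
    then have "(g has_derivative D) (at x)"
      by (rule has_derivative_transform_within_open[OF _ \<open>open S\<close> xS]) (use Suc.prems in auto)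
    then show ?thesis unfolding differentiable_def by blast
  qed
  moreover have "Ck_on k S (\<lambda>x. frechet_derivative g (at x) v)" for v
    by (rule Suc.IH[of "\<lambda>x. frechet_derivative f (at x) v"]) (use Suc.prems e in auto)
  ultimately show ?case by simp
qed

text \<open>The derivative at a point is unique, so any explicit formula \<open>D\<close> may stand
  in for \<open>frechet_derivative f\<close>. The closure rules below then follow by induction from
  the usual differentiation rules.\<close>

lemma Ck_on_SucI:
  assumes "open S" "\<And>x. x \<in> S \<Longrightarrow> (f has_derivative D x) (at x)"
    "\<And>v. Ck_on k S (\<lambda>x. D x v)"
  shows "Ck_on (Suc k) S f"
proof -
  have "D x = frechet_derivative f (at x)" if "x \<in> S" for x
    using frechet_derivative_at assms(2) that by blast
  then have "Ck_on k S (\<lambda>x. frechet_derivative f (at x) v)" for v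
    by (intro Ck_on_cong[OF assms(1) _ assms(3)[of v]]) auto
  then show ?thesis
    using assms(2) by (auto simp: differentiable_def)
qed

lemma Ck_on_Suc_has_derivative:
  "Ck_on (Suc k) S f \<Longrightarrow> x \<in> S \<Longrightarrow> (f has_derivative frechet_derivative f (at x)) (at x)"
  using frechet_derivative_works by auto

lemma Ck_on_Suc_D: "Ck_on (Suc k) S f \<Longrightarrow> Ck_on k S (\<lambda>x. frechet_derivative f (at x) v)"
  by simp

lemma Ck_on_Suc_imp: "Ck_on (Suc k) S f \<Longrightarrow> Ck_on k S f"
proof (induction k arbitrary: f)
  case 0
  then show ?case
    by (auto intro!: continuous_at_imp_continuous_on differentiable_imp_continuous_within)
next
  case (Suc k)
  then show ?case by (metis Ck_on.simps(2))
qed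

lemma Ck_on_const: "Ck_on k S (\<lambda>_. c)"
  by (induction k arbitrary: c) auto

lemma Ck_on_bounded_linear:
  assumes "open S" "bounded_linear h" "Ck_on k S f"
  shows "Ck_on k S (\<lambda>x. h (f x))"
  using assms(3)
proof (induction k arbitrary: f)
  case 0
  then show ?case
    using bounded_linear.continuous_on[OF assms(2)] by auto
next
  case (Suc k)
  show ?case
    by (rule Ck_on_SucI[OF assms(1) bounded_linear.has_derivative[OF assms(2) Ck_on_Suc_has_derivative[OF Suc.prems]]])
       (use Suc in auto)
qed

lemma Ck_on_linear:
  assumes "open S" "bounded_linear h"
  shows "Ck_on k S h"
proof (cases k)
  case 0
  then show ?thesis by (simp add: assms linear_continuous_on)
next
  case (Suc n)
  show ?thesis unfolding Suc
    by (rule Ck_on_SucI[OF assms(1) bounded_linear_imp_has_derivative[OF assms(2)] Ck_on_const])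
qed

lemma Ck_on_add:
  assumes "open S" "Ck_on k S f" "Ck_on k S g"
  shows "Ck_on k S (\<lambda>x. f x + g x)"
  using assms(2,3)
proof (induction k arbitrary: f g)
  case 0
  then show ?case by (auto intro: continuous_on_add)
next
  case (Suc k)
  show ?case
    by (rule Ck_on_SucI[OF assms(1) has_derivative_add
          [OF Ck_on_Suc_has_derivative[OF Suc.prems(1)] Ck_on_Suc_has_derivative[OF Suc.prems(2)]]])
       (use Suc in auto)
qed

lemma Ck_on_mult:
  fixes f g :: "'a::real_normed_vector \<Rightarrow> 'b::real_normed_algebra"
  assumes "open S" "Ck_on k S f" "Ck_on k S g"
  shows "Ck_on k S (\<lambda>x. f x * g x)"
  using assms(2,3)
proof (induction k arbitrary: f g)
  case 0
  then show ?case by (auto intro: continuous_on_mult)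
next
  case (Suc k)
  show ?case
    by (rule Ck_on_SucI[OF assms(1) has_derivative_mult
          [OF Ck_on_Suc_has_derivative[OF Suc.prems(1)] Ck_on_Suc_has_derivative[OF Suc.prems(2)]]])
       (assumption | intro Ck_on_add[OF assms(1)] Suc.IH Ck_on_Suc_imp[OF Suc.prems(1)]
          Ck_on_Suc_imp[OF Suc.prems(2)] Ck_on_Suc_D[OF Suc.prems(1)] Ck_on_Suc_D[OF Suc.prems(2)])+
qed

text \<open>The derivative of 1/f contains 1/f again, but only one order of differentiability less
  is asked of it, and the induction hypothesis supplies that.\<close>

lemma Ck_on_inverse:
  fixes f :: "'a::real_normed_vector \<Rightarrow> 'b::real_normed_field"
  assumes "open S" "Ck_on k S f" "\<And>x. x \<in> S \<Longrightarrow> f x \<noteq> 0"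
  shows "Ck_on k S (\<lambda>x. inverse (f x))"
  using assms(2)
proof (induction k)
  case 0
  then show ?case using assms(3) by (auto intro: continuous_on_inverse)
next
  case (Suc k)
  have i: "Ck_on k S (\<lambda>x. inverse (f x))"
    using Suc Ck_on_Suc_imp by blast
  have D: "((\<lambda>x. inverse (f x)) has_derivative
       (\<lambda>v. (-1) * (inverse (f x) * frechet_derivative f (at x) v * inverse (f x)))) (at x)" if "x \<in> S" for x
    using Deriv.has_derivative_inverse[OF assms(3)[OF that] Ck_on_Suc_has_derivative[OF Suc.prems that]] by simp
  show ?case
    by (rule Ck_on_SucI[OF assms(1) D])
       (assumption | intro Ck_on_mult[OF assms(1)] i Ck_on_Suc_D[OF Suc.prems] Ck_on_const)+
qed

text \<open>The same bootstrap as for the inverse. Avoiding the nonpositive reals makes the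
  principal branch differentiable and the denominator \<open>2 * csqrt (f x)\<close>
  nonzero.\<close>

lemma Ck_on_csqrt:
  fixes f :: "'a::real_normed_vector \<Rightarrow> complex"
  assumes "open S" "Ck_on k S f" "\<And>x. x \<in> S \<Longrightarrow> f x \<notin> \<real>\<^sub>\<le>\<^sub>0"
  shows "Ck_on k S (\<lambda>x. csqrt (f x))"
  using assms(2)
proof (induction k)
  case 0
  have "continuous_on (f ` S) csqrt"
    using assms(3) by (auto intro: continuous_at_imp_continuous_on continuous_at_csqrt)
  then show ?case
    using 0 by (auto intro: continuous_on_compose2)
next
  case (Suc k)
  have i: "Ck_on k S (\<lambda>x. csqrt (f x))"
    using Suc Ck_on_Suc_imp by blast
  have D: "((\<lambda>x. csqrt (f x)) has_derivative
       (\<lambda>v. frechet_derivative f (at x) v * inverse (2 * csqrt (f x)))) (at x)" if "x \<in> S" for x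
    using has_derivative_compose[OF Ck_on_Suc_has_derivative[OF Suc.prems that]
        has_field_derivative_csqrt[OF assms(3)[OF that], unfolded has_field_derivative_def]]
    by (simp add: mult_ac)
  have nz: "2 * csqrt (f x) \<noteq> 0" if "x \<in> S" for x
    using assms(3)[OF that] by auto
  have e: "Ck_on k S (\<lambda>x. frechet_derivative f (at x) v * inverse (2 * csqrt (f x)))" for v
    by (intro Ck_on_mult[OF assms(1)] Ck_on_inverse[OF assms(1)] i Ck_on_Suc_D[OF Suc.prems] Ck_on_const nz)
  show ?case
    by (rule Ck_on_SucI[OF assms(1) D e])
qed

section \<open>Symmetry of second derivatives\<close>

text \<open>The mean value theorem is applied twice: along \<open>u\<close> to the difference of
  \<open>f\<close> across \<open>h *\<^sub>R v\<close>, then along \<open>v\<close> to the resulting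
  difference of first derivatives. It needs real values, and \<open>box\<close> keeps all segments
  involved in \<open>S\<close>.\<close>

lemma second_difference_eq:
  fixes f :: "'a::real_normed_vector \<Rightarrow> real"
  assumes f: "Ck_on 2 S f" and h: "0 < h"
    and box: "\<And>s t. 0 \<le> s \<Longrightarrow> s \<le> h \<Longrightarrow> 0 \<le> t \<Longrightarrow> t \<le> h \<Longrightarrow> p + s *\<^sub>R u + t *\<^sub>R v \<in> S"
  shows "\<exists>s t. 0 < s \<and> s < h \<and> 0 < t \<and> t < h \<and>
      f (p + h *\<^sub>R u + h *\<^sub>R v) - f (p + h *\<^sub>R u) - f (p + h *\<^sub>R v) + f p
        = h * h * frechet_derivative (\<lambda>x. frechet_derivative f (at x) u) (at (p + s *\<^sub>R u + t *\<^sub>R v)) v"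
proof -
  have f2: "Ck_on (Suc (Suc 0)) S f" using f by (simp add: numeral_2_eq_2)
  let ?g = "\<lambda>x. frechet_derivative f (at x) u"
  have g1: "Ck_on (Suc 0) S ?g" using f2 by (rule Ck_on_Suc_D)
  have lin: "frechet_derivative k (at x) (a *\<^sub>R w) = a * frechet_derivative k (at x) w"
    if "Ck_on (Suc n) S k" "x \<in> S" for k :: "'a \<Rightarrow> real" and n x a w
    using linear_frechet_derivative that by (metis Ck_on.simps(2) linear_scale real_scaleR_def)
  let ?F = "\<lambda>s. f (p + s *\<^sub>R u + h *\<^sub>R v) - f (p + s *\<^sub>R u)"
  have F': "(?F has_real_derivative (?g (p + s *\<^sub>R u + h *\<^sub>R v) - ?g (p + s *\<^sub>R u))) (at s)"
    if s: "0 \<le> s" "s \<le> h" for s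
  proof -
    have i1: "p + s *\<^sub>R u + h *\<^sub>R v \<in> S" and i2: "p + s *\<^sub>R u \<in> S"
      using box[of s h] box[of s 0] s h by auto
    have "((\<lambda>s. f (p + s *\<^sub>R u + h *\<^sub>R v)) has_derivative
        (\<lambda>a. frechet_derivative f (at (p + s *\<^sub>R u + h *\<^sub>R v)) (a *\<^sub>R u))) (at s)"
      by (rule has_derivative_compose[where f = "\<lambda>s. p + s *\<^sub>R u + h *\<^sub>R v" and g = f,
            OF _ Ck_on_Suc_has_derivative[OF f2 i1]])
         (auto intro!: derivative_eq_intros)
    moreover have "((\<lambda>s. f (p + s *\<^sub>R u)) has_derivative
        (\<lambda>a. frechet_derivative f (at (p + s *\<^sub>R u)) (a *\<^sub>R u))) (at s)"
      by (rule has_derivative_compose[where f = "\<lambda>s. p + s *\<^sub>R u" and g = f,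
            OF _ Ck_on_Suc_has_derivative[OF f2 i2]])
         (auto intro!: derivative_eq_intros)
    ultimately have "(?F has_derivative (\<lambda>a. frechet_derivative f (at (p + s *\<^sub>R u + h *\<^sub>R v)) (a *\<^sub>R u)
        - frechet_derivative f (at (p + s *\<^sub>R u)) (a *\<^sub>R u))) (at s)"
      by (rule has_derivative_diff)
    moreover have "(\<lambda>a. frechet_derivative f (at (p + s *\<^sub>R u + h *\<^sub>R v)) (a *\<^sub>R u)
        - frechet_derivative f (at (p + s *\<^sub>R u)) (a *\<^sub>R u))
      = (*) (?g (p + s *\<^sub>R u + h *\<^sub>R v) - ?g (p + s *\<^sub>R u))"
      by (rule ext) (simp add: lin[OF f2 i1] lin[OF f2 i2] right_diff_distrib mult.commute)
    ultimately show ?thesis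
      unfolding has_field_derivative_def by simp
  qed
  obtain s where s: "0 < s" "s < h"
    and es: "?F h - ?F 0 = h * (?g (p + s *\<^sub>R u + h *\<^sub>R v) - ?g (p + s *\<^sub>R u))"
    using MVT2[OF h F'] by auto
  let ?G = "\<lambda>t. ?g (p + s *\<^sub>R u + t *\<^sub>R v)"
  have G': "(?G has_real_derivative frechet_derivative ?g (at (p + s *\<^sub>R u + t *\<^sub>R v)) v) (at t)"
    if t: "0 \<le> t" "t \<le> h" for t
  proof -
    have i1: "p + s *\<^sub>R u + t *\<^sub>R v \<in> S"
      using box[of s t] s t by auto
    have "(?G has_derivative
        (\<lambda>a. frechet_derivative ?g (at (p + s *\<^sub>R u + t *\<^sub>R v)) (a *\<^sub>R v))) (at t)"
      by (rule has_derivative_compose[where f = "\<lambda>t. p + s *\<^sub>R u + t *\<^sub>R v" and g = "?g",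
            OF _ Ck_on_Suc_has_derivative[OF g1 i1]])
         (auto intro!: derivative_eq_intros)
    then show ?thesis
      unfolding has_field_derivative_def
      by (rule has_derivative_eq_rhs) (auto simp: lin[OF g1 i1])
  qed
  obtain t where t: "0 < t" "t < h"
    and et: "?G h - ?G 0 = h * frechet_derivative ?g (at (p + s *\<^sub>R u + t *\<^sub>R v)) v"
    using MVT2[OF h G'] by auto
  have "f (p + h *\<^sub>R u + h *\<^sub>R v) - f (p + h *\<^sub>R u) - f (p + h *\<^sub>R v) + f p
      = ?F h - ?F 0" by simp
  also have "\<dots> = h * h * frechet_derivative ?g (at (p + s *\<^sub>R u + t *\<^sub>R v)) v"
    using es et by simp
  finally show ?thesis using s t by blast
qed

text \<open>Schwarz's theorem. The second difference over a parallelogram is symmetric in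
  \<open>u\<close> and \<open>v\<close>, so the two mixed derivatives agree when each is taken at a
  suitable point near \<open>p\<close>; continuity closes the gap as the parallelogram
  shrinks.\<close>

lemma frechet_derivative_commute_real:
  fixes f :: "'a::real_normed_vector \<Rightarrow> real"
  assumes "open S" "Ck_on 2 S f" "p \<in> S"
  shows "frechet_derivative (\<lambda>x. frechet_derivative f (at x) u) (at p) v
       = frechet_derivative (\<lambda>x. frechet_derivative f (at x) v) (at p) u"
proof -
  define A where "A u v x = frechet_derivative (\<lambda>x. frechet_derivative f (at x) u) (at x) v" for u v x
  have "Ck_on 0 S (A u v)" for u v
    using assms(2) unfolding numeral_2_eq_2 A_def by (metis Ck_on_Suc_D)
  then have cont: "isCont (A u v) p" for u v
    using assms(1,3) by (simp add: continuous_on_eq_continuous_at)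
  have "\<bar>A u v p - A v u p\<bar> < e" if "e > 0" for e
  proof -
    obtain d0 where d0: "d0 > 0" "\<And>x. dist x p < d0 \<Longrightarrow> x \<in> S"
      using assms(1,3) unfolding open_dist by blast
    obtain d1 where d1: "d1 > 0" "\<And>x. dist x p < d1 \<Longrightarrow> \<bar>A u v x - A u v p\<bar> < e / 2"
      using cont[of u v] \<open>e > 0\<close> unfolding continuous_at_eps_delta dist_real_def
      by (metis half_gt_zero)
    obtain d2 where d2: "d2 > 0" "\<And>x. dist x p < d2 \<Longrightarrow> \<bar>A v u x - A v u p\<bar> < e / 2"
      using cont[of v u] \<open>e > 0\<close> unfolding continuous_at_eps_delta dist_real_def
      by (metis half_gt_zero)
    define d where "d = min d0 (min d1 d2)"
    \<comment> \<open>Puts the whole parallelogram within distance \<open>d\<close> of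
      \<open>p\<close>; the summand 1 keeps the denominator positive when both directions
      vanish.\<close>
    define h where "h = d / (norm u + norm v + 1)"
    have d: "d > 0" using d0 d1 d2 by (simp add: d_def)
    have pos: "norm u + norm v + 1 > 0" by (smt (verit) norm_ge_zero)
    then have h: "h > 0" using d by (simp add: h_def)
    have hd: "h * (norm u + norm v) < d"
    proof -
      have "h * (norm u + norm v) < h * (norm u + norm v + 1)" using h by simp
      also have "\<dots> = d" using pos unfolding h_def by simp
      finally show ?thesis .
    qed
    have near: "dist (p + s *\<^sub>R u + t *\<^sub>R v) p < d"
      if "0 \<le> s" "s \<le> h" "0 \<le> t" "t \<le> h" for s t
    proof -
      have "dist (p + s *\<^sub>R u + t *\<^sub>R v) p = norm (s *\<^sub>R u + t *\<^sub>R v)"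
        by (simp add: dist_norm algebra_simps)
      also have "\<dots> \<le> s * norm u + t * norm v"
        using norm_triangle_ineq[of "s *\<^sub>R u" "t *\<^sub>R v"] that by simp
      also have "\<dots> \<le> h * norm u + h * norm v"
        using that by (intro add_mono mult_right_mono) auto
      finally show ?thesis using hd by (simp add: algebra_simps)
    qed
    have near': "dist (p + t *\<^sub>R v + s *\<^sub>R u) p < d"
      if "0 \<le> s" "s \<le> h" "0 \<le> t" "t \<le> h" for s t
      using near[OF that] by (simp add: add_ac)
    have inS: "p + s *\<^sub>R u + t *\<^sub>R v \<in> S"
      if "0 \<le> s" "s \<le> h" "0 \<le> t" "t \<le> h" for s t
      using near[OF that] d0 by (auto simp: d_def)
    have inS': "p + t *\<^sub>R v + s *\<^sub>R u \<in> S"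
      if "0 \<le> t" "t \<le> h" "0 \<le> s" "s \<le> h" for s t
      using near'[of s t] that d0 by (auto simp: d_def)
    obtain s t where st: "0 < s" "s < h" "0 < t" "t < h"
      and 1: "f (p + h *\<^sub>R u + h *\<^sub>R v) - f (p + h *\<^sub>R u) - f (p + h *\<^sub>R v) + f p
        = h * h * A u v (p + s *\<^sub>R u + t *\<^sub>R v)"
      using second_difference_eq[OF assms(2) h inS] unfolding A_def by blast
    obtain s' t' where st': "0 < s'" "s' < h" "0 < t'" "t' < h"
      and 2: "f (p + h *\<^sub>R v + h *\<^sub>R u) - f (p + h *\<^sub>R v) - f (p + h *\<^sub>R u) + f p
        = h * h * A v u (p + s' *\<^sub>R v + t' *\<^sub>R u)"
      using second_difference_eq[OF assms(2) h inS'] unfolding A_def by blast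
    have "h * h * A u v (p + s *\<^sub>R u + t *\<^sub>R v) = h * h * A v u (p + s' *\<^sub>R v + t' *\<^sub>R u)"
    proof -
      have e: "p + h *\<^sub>R v + h *\<^sub>R u = p + h *\<^sub>R u + h *\<^sub>R v" by (simp add: add_ac)
      show ?thesis using 1 2 unfolding e by linarith
    qed
    then have "A u v (p + s *\<^sub>R u + t *\<^sub>R v) = A v u (p + s' *\<^sub>R v + t' *\<^sub>R u)"
      using h by simp
    moreover have "\<bar>A u v (p + s *\<^sub>R u + t *\<^sub>R v) - A u v p\<bar> < e / 2"
      using d1(2) near[of s t] st by (auto simp: d_def)
    moreover have "\<bar>A v u (p + s' *\<^sub>R v + t' *\<^sub>R u) - A v u p\<bar> < e / 2"
      using d2(2) near'[of t' s'] st' by (auto simp: d_def)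
    ultimately show ?thesis by linarith
  qed
  then have "\<bar>A u v p - A v u p\<bar> \<le> 0" by (meson less_irrefl not_le)
  then show ?thesis by (simp add: A_def)
qed

lemma frechet_derivative_bounded_linear:
  assumes "bounded_linear h" "f differentiable (at x)"
  shows "frechet_derivative (\<lambda>x. h (f x)) (at x) v = h (frechet_derivative f (at x) v)"
  using frechet_derivative_at[OF bounded_linear.has_derivative[OF assms(1)
      assms(2)[unfolded frechet_derivative_works]]] by metis

text \<open>Real and imaginary parts reduce this to the real case, because a bounded real-linear
  functional passes through both differentiations.\<close>

lemma frechet_derivative_commute:
  fixes f :: "'a::real_normed_vector \<Rightarrow> complex"
  assumes "open S" "Ck_on 2 S f" "p \<in> S"
  shows "frechet_derivative (\<lambda>x. frechet_derivative f (at x) u) (at p) v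
       = frechet_derivative (\<lambda>x. frechet_derivative f (at x) v) (at p) u"
proof -
  have f2: "Ck_on (Suc (Suc 0)) S f" using assms(2) by (simp add: numeral_2_eq_2)
  have 1: "h (frechet_derivative (\<lambda>x. frechet_derivative f (at x) u) (at p) v)
       = frechet_derivative (\<lambda>x. frechet_derivative (\<lambda>x. h (f x)) (at x) u) (at p) v"
    if h: "bounded_linear h" for h :: "complex \<Rightarrow> real" and u v
  proof -
    have diff: "(\<lambda>x. frechet_derivative f (at x) u) differentiable (at x)" if "x \<in> S" for x
      using f2 that by simp
    have "h (frechet_derivative (\<lambda>x. frechet_derivative f (at x) u) (at p) v)
      = frechet_derivative (\<lambda>x. h (frechet_derivative f (at x) u)) (at p) v"
      using frechet_derivative_bounded_linear[OF h diff[OF assms(3)]] by simp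
    also have "\<dots> = frechet_derivative (\<lambda>x. frechet_derivative (\<lambda>x. h (f x)) (at x) u) (at p) v"
    proof -
      have "frechet_derivative (\<lambda>x. h (frechet_derivative f (at x) u)) (at p)
          = frechet_derivative (\<lambda>x. frechet_derivative (\<lambda>x. h (f x)) (at x) u) (at p)"
      proof (rule frechet_derivative_transform_within_open[OF _ assms(1,3)])
        show "(\<lambda>x. h (frechet_derivative f (at x) u)) differentiable (at p)"
          using diff[OF assms(3)] bounded_linear.has_derivative[OF h]
          unfolding differentiable_def by blast
        show "h (frechet_derivative f (at x) u) = frechet_derivative (\<lambda>x. h (f x)) (at x) u"
          if "x \<in> S" for x
          using f2 that by (simp add: frechet_derivative_bounded_linear[OF h])
      qed
      then show ?thesis by simp
    qed
    finally show ?thesis .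
  qed
  show ?thesis
    using frechet_derivative_commute_real[OF assms(1) Ck_on_bounded_linear[OF assms(1) bounded_linear_Re assms(2)] assms(3)]
      frechet_derivative_commute_real[OF assms(1) Ck_on_bounded_linear[OF assms(1) bounded_linear_Im assms(2)] assms(3)]
    by (auto intro!: complex_eqI simp: 1[OF bounded_linear_Re] 1[OF bounded_linear_Im])
qed

section \<open>Closure properties of smooth functions\<close>

lemma smooth_on_cong:
  "open S \<Longrightarrow> (\<And>x. x \<in> S \<Longrightarrow> f x = g x) \<Longrightarrow> smooth_on S f \<Longrightarrow> smooth_on S g"
  unfolding smooth_on_def using Ck_on_cong by blast

lemma smooth_on_const: "smooth_on S (\<lambda>_. c)"
  unfolding smooth_on_def using Ck_on_const by blast

lemma smooth_on_linear: "open S \<Longrightarrow> bounded_linear h \<Longrightarrow> smooth_on S h"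
  unfolding smooth_on_def using Ck_on_linear by blast

lemma smooth_on_bounded_linear:
  "open S \<Longrightarrow> bounded_linear h \<Longrightarrow> smooth_on S f \<Longrightarrow> smooth_on S (\<lambda>x. h (f x))"
  unfolding smooth_on_def using Ck_on_bounded_linear by blast

lemmas smooth_on_cnj = smooth_on_bounded_linear[OF _ bounded_linear_cnj]

lemma smooth_on_add:
  "open S \<Longrightarrow> smooth_on S f \<Longrightarrow> smooth_on S g \<Longrightarrow> smooth_on S (\<lambda>x. f x + g x)"
  unfolding smooth_on_def using Ck_on_add by blast

lemma smooth_on_mult:
  fixes f g :: "'a::real_normed_vector \<Rightarrow> 'b::real_normed_algebra"
  shows "open S \<Longrightarrow> smooth_on S f \<Longrightarrow> smooth_on S g \<Longrightarrow> smooth_on S (\<lambda>x. f x * g x)"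
  unfolding smooth_on_def using Ck_on_mult by blast

lemma smooth_on_minus: "open S \<Longrightarrow> smooth_on S f \<Longrightarrow> smooth_on S (\<lambda>x. - f x)"
  using smooth_on_bounded_linear[OF _ bounded_linear_minus[OF bounded_linear_ident]] .

lemma smooth_on_diff:
  "open S \<Longrightarrow> smooth_on S f \<Longrightarrow> smooth_on S g \<Longrightarrow> smooth_on S (\<lambda>x. f x - g x)"
  using smooth_on_add[OF _ _ smooth_on_minus, of S f g] by simp

lemma smooth_on_sum:
  "open S \<Longrightarrow> (\<And>i. i \<in> J \<Longrightarrow> smooth_on S (f i)) \<Longrightarrow> smooth_on S (\<lambda>x. \<Sum>i\<in>J. f i x)"
  by (induction J rule: infinite_finite_induct) (auto intro!: smooth_on_const smooth_on_add)

lemma smooth_on_divide: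
  fixes f g :: "'a::real_normed_vector \<Rightarrow> 'b::real_normed_field"
  assumes "open S" "smooth_on S f" "smooth_on S g" "\<And>x. x \<in> S \<Longrightarrow> g x \<noteq> 0"
  shows "smooth_on S (\<lambda>x. f x / g x)"
  unfolding smooth_on_def divide_inverse
proof
  fix k
  show "Ck_on k S (\<lambda>x. f x * inverse (g x))"
    using assms unfolding smooth_on_def by (intro Ck_on_mult Ck_on_inverse) auto
qed

lemma smooth_on_csqrt:
  "open S \<Longrightarrow> smooth_on S f \<Longrightarrow> (\<And>x. x \<in> S \<Longrightarrow> f x \<notin> \<real>\<^sub>\<le>\<^sub>0) \<Longrightarrow> smooth_on S (\<lambda>x. csqrt (f x))"
  unfolding smooth_on_def using Ck_on_csqrt by blast

lemma smooth_on_frechet_derivative: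
  "smooth_on S f \<Longrightarrow> smooth_on S (\<lambda>x. frechet_derivative f (at x) v)"
  unfolding smooth_on_def using Ck_on_Suc_D by blast

lemma smooth_on_has_derivative:
  "smooth_on S f \<Longrightarrow> x \<in> S \<Longrightarrow> (f has_derivative frechet_derivative f (at x)) (at x)"
  unfolding smooth_on_def using Ck_on_Suc_has_derivative by blast

section \<open>Derivations and Wirtinger operators\<close>

text \<open>Axioms shared by the coordinate derivatives and \<open>delta\<close>, so that each rule
  is proved once. The last clause is locality: a function may be replaced by a formula valid only on
  \<open>S\<close>.\<close>

definition derivation_on :: "'a::real_normed_vector set \<Rightarrow> (('a \<Rightarrow> complex) \<Rightarrow> 'a \<Rightarrow> complex) \<Rightarrow> bool" where
  "derivation_on S X \<longleftrightarrow>
     (\<forall>f g p. smooth_on S f \<longrightarrow> smooth_on S g \<longrightarrow> p \<in> S \<longrightarrow>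
        X (\<lambda>q. f q + g q) p = X f p + X g p \<and>
        X (\<lambda>q. f q * g q) p = X f p * g p + f p * X g p) \<and>
     (\<forall>c. \<forall>p\<in>S. X (\<lambda>_. c) p = 0) \<and>
     (\<forall>f g p. smooth_on S f \<longrightarrow> (\<forall>q\<in>S. f q = g q) \<longrightarrow> p \<in> S \<longrightarrow> X f p = X g p)"

context
  fixes S :: "'a::real_normed_vector set" and X :: "('a \<Rightarrow> complex) \<Rightarrow> 'a \<Rightarrow> complex"
  assumes X: "derivation_on S X" and S: "open S"
begin

lemma derivation_add:
  "smooth_on S f \<Longrightarrow> smooth_on S g \<Longrightarrow> p \<in> S \<Longrightarrow> X (\<lambda>q. f q + g q) p = X f p + X g p"
  using X unfolding derivation_on_def by blast

lemma derivation_mult: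
  "smooth_on S f \<Longrightarrow> smooth_on S g \<Longrightarrow> p \<in> S \<Longrightarrow>
    X (\<lambda>q. f q * g q) p = X f p * g p + f p * X g p"
  using X unfolding derivation_on_def by blast

lemma derivation_const: "p \<in> S \<Longrightarrow> X (\<lambda>_. c) p = 0"
  using X unfolding derivation_on_def by blast

lemma derivation_cong:
  "smooth_on S f \<Longrightarrow> (\<And>q. q \<in> S \<Longrightarrow> f q = g q) \<Longrightarrow> p \<in> S \<Longrightarrow> X f p = X g p"
  using X unfolding derivation_on_def by blast

lemma derivation_cmult: "smooth_on S f \<Longrightarrow> p \<in> S \<Longrightarrow> X (\<lambda>q. c * f q) p = c * X f p"
  by (simp add: derivation_mult derivation_const smooth_on_const)

lemma derivation_minus: "smooth_on S f \<Longrightarrow> p \<in> S \<Longrightarrow> X (\<lambda>q. - f q) p = - X f p"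
  using derivation_cmult[of f p "-1"] by simp

lemma derivation_diff:
  "smooth_on S f \<Longrightarrow> smooth_on S g \<Longrightarrow> p \<in> S \<Longrightarrow> X (\<lambda>q. f q - g q) p = X f p - X g p"
  using derivation_add[of f "\<lambda>q. - g q" p] by (simp add: derivation_minus smooth_on_minus S)

lemma derivation_sum:
  assumes "\<And>i. i \<in> J \<Longrightarrow> smooth_on S (f i)" "p \<in> S"
  shows "X (\<lambda>q. \<Sum>i\<in>J. f i q) p = (\<Sum>i\<in>J. X (f i) p)"
  using assms
  by (induction J rule: infinite_finite_induct)
     (auto simp: derivation_const derivation_add smooth_on_sum S)

text \<open>The Leibniz rule for \<open>f = (f / g) * g\<close>, solved for the derivative of the
  quotient.\<close>

lemma derivation_divide:
  assumes "smooth_on S f" "smooth_on S g" "\<And>q. q \<in> S \<Longrightarrow> g q \<noteq> 0" "p \<in> S"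
  shows "X (\<lambda>q. f q / g q) p = (X f p - f p / g p * X g p) / g p"
proof -
  have sm: "smooth_on S (\<lambda>q. f q / g q)"
    using assms by (intro smooth_on_divide S)
  have "X f p = X (\<lambda>q. f q / g q * g q) p"
    by (rule derivation_cong[OF _ _ assms(4)]) (use assms in auto)
  also have "\<dots> = X (\<lambda>q. f q / g q) p * g p + f p / g p * X g p"
    by (rule derivation_mult[OF sm assms(2,4)])
  finally show ?thesis using assms(3)[OF assms(4)] by simp
qed

text \<open>The Leibniz rule for \<open>f * f = g\<close>. It serves \<open>F\<close> as a root of
  \<open>Lfun F\<close> and \<open>sqrt_g F\<close> as a root of the determinant.\<close>

lemma derivation_square_root:
  assumes "smooth_on S f" "\<And>q. q \<in> S \<Longrightarrow> f q * f q = g q" "p \<in> S" "f p \<noteq> 0"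
  shows "X f p = X g p / (2 * f p)"
proof -
  have "X g p = X (\<lambda>q. f q * f q) p"
    by (rule derivation_cong[OF _ _ assms(3), symmetric])
       (use assms in \<open>auto intro!: smooth_on_mult S\<close>)
  also have "\<dots> = 2 * f p * X f p"
    by (simp add: derivation_mult assms algebra_simps)
  finally show ?thesis using assms(4) by simp
qed

end

lemma derivation_on_frechet_derivative:
  assumes S: "open S"
  shows "derivation_on S (\<lambda>f p. frechet_derivative f (at p) v)"
  unfolding derivation_on_def
proof (intro conjI allI impI ballI)
  fix f g :: "'a \<Rightarrow> complex" and p
  assume f: "smooth_on S f" and p: "p \<in> S"
  note Df = smooth_on_has_derivative[OF f p]
  show "frechet_derivative (\<lambda>q. f q + g q) (at p) v
      = frechet_derivative f (at p) v + frechet_derivative g (at p) v" if g: "smooth_on S g"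
    using frechet_derivative_at[OF has_derivative_add[OF Df smooth_on_has_derivative[OF g p]]]
    by metis
  show "frechet_derivative (\<lambda>q. f q * g q) (at p) v
      = frechet_derivative f (at p) v * g p + f p * frechet_derivative g (at p) v" if g: "smooth_on S g"
    using fun_cong[OF frechet_derivative_at[OF has_derivative_mult[OF Df smooth_on_has_derivative[OF g p]]], of v]
    by (simp add: add.commute)
  show "frechet_derivative f (at p) v = frechet_derivative g (at p) v" if "\<forall>q\<in>S. f q = g q"
    using frechet_derivative_transform_within_open[OF differentiableI[OF Df] S p, of g] that by simp
qed auto

text \<open>The axioms are checked point by point, so the coefficients may vary with the point. This
  covers the Wirtinger operators and also \<open>delta\<close>, whose fibre coefficients are
  \<open>- N_conn\<close>.\<close>

lemma derivation_on_lincomb: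
  assumes "derivation_on S X" "\<And>j. j \<in> J \<Longrightarrow> derivation_on S (Y j)"
  shows "derivation_on S (\<lambda>f p. c p * X f p + (\<Sum>j\<in>J. a j p * Y j f p))"
proof -
  have X: "X (\<lambda>q. f q + g q) p = X f p + X g p" "X (\<lambda>q. f q * g q) p = X f p * g p + f p * X g p"
    if "smooth_on S f" "smooth_on S g" "p \<in> S" for f g p
    using assms(1) that unfolding derivation_on_def by blast+
  have Y: "Y j (\<lambda>q. f q + g q) p = Y j f p + Y j g p" "Y j (\<lambda>q. f q * g q) p = Y j f p * g p + f p * Y j g p"
    if "j \<in> J" "smooth_on S f" "smooth_on S g" "p \<in> S" for f g p j
    using assms(2)[OF that(1)] that unfolding derivation_on_def by blast+
  have XYc: "X (\<lambda>_. k) p = 0" "j \<in> J \<Longrightarrow> Y j (\<lambda>_. k) p = 0" if "p \<in> S" for k p j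
    using assms that unfolding derivation_on_def by blast+
  have Xe: "X f p = X g p" if "smooth_on S f" "\<forall>q\<in>S. f q = g q" "p \<in> S" for f g p
    using assms(1) that unfolding derivation_on_def by blast
  have Ye: "Y j f p = Y j g p" if "j \<in> J" "smooth_on S f" "\<forall>q\<in>S. f q = g q" "p \<in> S" for f g p j
    using assms(2)[OF that(1)] that unfolding derivation_on_def by blast
  show ?thesis
    unfolding derivation_on_def
  proof (intro conjI allI impI ballI)
    fix f g :: "'a \<Rightarrow> complex" and p
    assume f: "smooth_on S f" and p: "p \<in> S"
    show "c p * X f p + (\<Sum>j\<in>J. a j p * Y j f p) = c p * X g p + (\<Sum>j\<in>J. a j p * Y j g p)"
      if "\<forall>q\<in>S. f q = g q"
      using Xe[OF f that p] Ye[OF _ f that p] by simp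
    assume g: "smooth_on S g"
    show "c p * X (\<lambda>q. f q + g q) p + (\<Sum>j\<in>J. a j p * Y j (\<lambda>q. f q + g q) p) =
        c p * X f p + (\<Sum>j\<in>J. a j p * Y j f p) + (c p * X g p + (\<Sum>j\<in>J. a j p * Y j g p))"
      by (simp add: X[OF f g p] Y[OF _ f g p] distrib_left sum.distrib)
    show "c p * X (\<lambda>q. f q * g q) p + (\<Sum>j\<in>J. a j p * Y j (\<lambda>q. f q * g q) p) =
        (c p * X f p + (\<Sum>j\<in>J. a j p * Y j f p)) * g p + f p * (c p * X g p + (\<Sum>j\<in>J. a j p * Y j g p))"
      by (simp add: X[OF f g p] Y[OF _ f g p] distrib_left distrib_right sum.distrib
          sum_distrib_left sum_distrib_right mult_ac)
  qed (simp add: XYc)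
qed

section \<open>Wirtinger operators\<close>

text \<open>Common shape of the three families of coordinate derivatives: \<open>u\<close> and
  \<open>v\<close> are the real and imaginary coordinate directions, \<open>a = - \<i>\<close> gives
  the holomorphic derivative and \<open>a = \<i>\<close> the conjugate one.\<close>

definition wirtinger :: "complex \<Rightarrow> 'a \<Rightarrow> 'a \<Rightarrow> ('a::real_normed_vector \<Rightarrow> complex) \<Rightarrow> 'a \<Rightarrow> complex" where
  "wirtinger a u v f p = (frechet_derivative f (at p) u + a * frechet_derivative f (at p) v) / 2"

lemma derivation_on_wirtinger:
  assumes "open S"
  shows "derivation_on S (wirtinger a u v)"
  \<comment> \<open>The one-element index set \<open>{()}\<close> makes the two-term formula an
    instance of the general combination.\<close>
  using derivation_on_lincomb[of S "\<lambda>f p. frechet_derivative f (at p) u" "{()}"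
      "\<lambda>_ f p. frechet_derivative f (at p) v" "\<lambda>_. 1/2" "\<lambda>_ _. a / 2"]
    derivation_on_frechet_derivative[OF assms]
  by (simp add: wirtinger_def[abs_def] add_divide_distrib)

lemma smooth_on_wirtinger:
  assumes "open S" "smooth_on S f"
  shows "smooth_on S (wirtinger a u v f)"
  unfolding wirtinger_def[abs_def]
  by (intro smooth_on_divide smooth_on_add smooth_on_mult smooth_on_const assms
      smooth_on_frechet_derivative) auto

text \<open>Expanding both operators leaves four second derivatives in real directions, each
  symmetric by \<open>frechet_derivative_commute\<close>.\<close>

lemma wirtinger_commute:
  assumes S: "open S" and f: "smooth_on S f" and p: "p \<in> S"
  shows "wirtinger a u v (wirtinger b w x f) p = wirtinger b w x (wirtinger a u v f) p"
proof -
  have c: "frechet_derivative (\<lambda>q. frechet_derivative f (at q) u) (at p) v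
       = frechet_derivative (\<lambda>q. frechet_derivative f (at q) v) (at p) u" for u v
    using frechet_derivative_commute[OF S _ p] f unfolding smooth_on_def by blast
  have e: "frechet_derivative (wirtinger a u v f) (at p) w =
     (frechet_derivative (\<lambda>q. frechet_derivative f (at q) u) (at p) w
      + a * frechet_derivative (\<lambda>q. frechet_derivative f (at q) v) (at p) w) / 2" for a u v w
  proof -
    note D = derivation_on_frechet_derivative[OF S]
    note sm = smooth_on_frechet_derivative[OF f]
    have "frechet_derivative
        (\<lambda>p. (1/2) * (frechet_derivative f (at p) u + a * frechet_derivative f (at p) v)) (at p) w =
     (1/2) * (frechet_derivative (\<lambda>q. frechet_derivative f (at q) u) (at p) w
      + a * frechet_derivative (\<lambda>q. frechet_derivative f (at q) v) (at p) w)"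
      by (simp only: derivation_cmult[OF D S] derivation_add[OF D S] p sm smooth_on_add
          smooth_on_mult smooth_on_const S)
    then show ?thesis by (simp add: wirtinger_def[abs_def])
  qed
  show ?thesis
    unfolding wirtinger_def[of a u v "wirtinger b w x f"] wirtinger_def[of b w x "wirtinger a u v f"] e
    by (simp add: c[of w u] c[of w v] c[of x u] c[of x v] field_simps)
qed

lemma d_z_eq_wirtinger: "d_z k = wirtinger (- \<i>) (axis k 1, 0) (axis k \<i>, 0)"
  by (intro ext) (simp add: d_z_def wirtinger_def)

lemma d_eta_eq_wirtinger: "d_eta k = wirtinger (- \<i>) (0, axis k 1) (0, axis k \<i>)"
  by (intro ext) (simp add: d_eta_def wirtinger_def)

lemma d_etabar_eq_wirtinger: "d_etabar k = wirtinger \<i> (0, axis k 1) (0, axis k \<i>)"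
  by (intro ext) (simp add: d_etabar_def wirtinger_def)

lemmas coordinate_derivative_eqs = d_z_eq_wirtinger d_eta_eq_wirtinger d_etabar_eq_wirtinger

section \<open>Coordinate functions and derivatives along the fibres\<close>

lemma frechet_derivative_linear:
  "bounded_linear h \<Longrightarrow> frechet_derivative h (at p) = h"
  using frechet_derivative_at[OF bounded_linear_imp_has_derivative] by metis

lemma bounded_linear_eta: "bounded_linear (\<lambda>p. snd p $ i :: complex)"
  by (rule bounded_linear_compose[OF bounded_linear_vec_nth bounded_linear_snd])

lemma bounded_linear_cnj_eta: "bounded_linear (\<lambda>p. cnj (snd p $ i))"
  by (rule bounded_linear_compose[OF bounded_linear_cnj bounded_linear_eta])

lemma d_eta_coordinates [simp]:
  "d_eta k (\<lambda>p. snd p $ i) p = (if i = k then 1 else 0)" "d_eta k (\<lambda>p. cnj (snd p $ i)) p = 0"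
  "d_etabar k (\<lambda>p. snd p $ i) p = 0"
  "d_z k (\<lambda>p. snd p $ i) p = 0" "d_z k (\<lambda>p. cnj (snd p $ i)) p = 0"
  by (auto simp: d_eta_def d_etabar_def d_z_def axis_def
      frechet_derivative_linear[OF bounded_linear_eta] frechet_derivative_linear[OF bounded_linear_cnj_eta])

lemma d_etabar_cnj:
  assumes "f differentiable (at p)"
  shows "d_etabar k (\<lambda>p. cnj (f p)) p = cnj (d_eta k f p)"
  by (simp add: d_eta_def d_etabar_def frechet_derivative_bounded_linear[OF bounded_linear_cnj assms])

text \<open>Both sides are the complex-linear part of the derivative, evaluated in the fibre
  direction \<open>v\<close>. This converts radial derivatives of \<open>Lfun F\<close> into Euler's
  identity.\<close>

lemma sum_eta_d_eta:
  fixes f :: "2 cfun"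
  assumes "f differentiable (at p)"
  shows "(\<Sum>k\<in>UNIV. v $ k * d_eta k f p)
     = (frechet_derivative f (at p) (0, v) - \<i> * frechet_derivative f (at p) (0, \<i> *s v)) / 2"
proof -
  define A where "A = frechet_derivative f (at p)"
  have lin: "linear A" unfolding A_def by (rule linear_frechet_derivative[OF assms])
  have dec: "(0, w) = Re (w $ 1) *\<^sub>R (0, axis 1 1) + Im (w $ 1) *\<^sub>R (0, axis 1 \<i>)
      + Re (w $ 2) *\<^sub>R (0, axis 2 1) + (Im (w $ 2) *\<^sub>R (0, axis 2 \<i>) :: (complex^2) \<times> (complex^2))" for w :: "complex^2"
    by (auto simp: vec_eq_iff forall_2 axis_def complex_eq_iff)
  have A: "A (0, w) = Re (w $ 1) * A (0, axis 1 1) + Im (w $ 1) * A (0, axis 1 \<i>)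
      + Re (w $ 2) * A (0, axis 2 1) + Im (w $ 2) * A (0, axis 2 \<i>)" for w :: "complex^2"
    by (subst dec) (simp only: linear_add[OF lin] linear_scale[OF lin] scaleR_conv_of_real)
  show ?thesis
    unfolding d_eta_def A_def[symmetric] sum_2 A[of v] A[of "\<i> *s v"]
    by (simp add: complex_eq_iff field_simps)
qed

lemma derivative_along_line:
  assumes "f differentiable (at p)"
  shows "((\<lambda>t. f (p + t *\<^sub>R v)) has_vector_derivative frechet_derivative f (at p) v) (at 0)"
proof -
  have f: "(f has_derivative frechet_derivative f (at p)) (at (p + 0 *\<^sub>R v))"
    using assms[unfolded frechet_derivative_works] by simp
  have "((\<lambda>t. f (p + t *\<^sub>R v)) has_derivative (\<lambda>a. frechet_derivative f (at p) (a *\<^sub>R v))) (at 0)"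
    by (rule has_derivative_compose[where f = "\<lambda>t. p + t *\<^sub>R v" and g = f, OF _ f])
       (auto intro!: derivative_eq_intros)
  then show ?thesis
    unfolding has_vector_derivative_def
    by (simp add: linear_scale[OF linear_frechet_derivative[OF assms]])
qed

lemma eventually_line_in_open:
  fixes S :: "'a::real_normed_vector set"
  assumes "open S" "p \<in> S"
  shows "eventually (\<lambda>t. p + t *\<^sub>R v \<in> S) (nhds (0::real))"
proof -
  have "open ((\<lambda>t. p + t *\<^sub>R v) -` S)"
    by (intro open_vimage assms continuous_intros)
  then show ?thesis
    using eventually_nhds_in_open[of "(\<lambda>t. p + t *\<^sub>R v) -` S" 0] assms(2) by simp
qed

text \<open>A short segment through \<open>p\<close> in a fibre direction stays in the open set
  \<open>S\<close>, and \<open>f\<close> is constant along it.\<close>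

lemma frechet_derivative_eta_const:
  fixes f :: "('a::real_normed_vector \<times> 'b::real_normed_vector) \<Rightarrow> complex"
  assumes "open S" "p \<in> S" "f differentiable (at p)" "\<And>q. q \<in> S \<Longrightarrow> f q = h (fst q)"
  shows "frechet_derivative f (at p) (0, v) = 0"
proof -
  have const: "f (p + t *\<^sub>R (0, v)) = f p" if "p + t *\<^sub>R (0, v) \<in> S" for t
    using assms(4)[OF that] assms(4)[OF assms(2)] by simp
  have "eventually (\<lambda>t. f (p + t *\<^sub>R (0, v)) = f p) (nhds (0::real))"
    using eventually_line_in_open[OF assms(1,2)] by eventually_elim (rule const)
  then have "((\<lambda>t. f (p + t *\<^sub>R (0, v))) has_vector_derivative 0) (at 0)"
    by (subst has_vector_derivative_cong_ev[where g = "\<lambda>_. f p"])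
       (auto intro: derivative_eq_intros simp: eventually_nhds)
  then show ?thesis
    using derivative_along_line[OF assms(3)] vector_derivative_unique_at by blast
qed

lemma positive_definite_2_det:
  fixes H :: "complex^2^2"
  assumes "positive_definite H"
  shows "\<exists>r>0. det H = complex_of_real r"
proof -
  have herm: "H $ j $ i = cnj (H $ i $ j)" for i j
    using assms unfolding positive_definite_def by blast
  have pos: "v \<noteq> 0 \<Longrightarrow> 0 < Re (\<Sum>i\<in>UNIV. \<Sum>j\<in>UNIV. H $ i $ j * v $ i * cnj (v $ j))" for v
    using assms unfolding positive_definite_def by blast
  define a d where "a = Re (H $ 1 $ 1)" and "d = Re (H $ 2 $ 2)"
  have a: "H $ 1 $ 1 = of_real a" and d: "H $ 2 $ 2 = of_real d"
    using herm[of 1 1] herm[of 2 2] by (auto simp: a_def d_def complex_eq_iff)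
  define b where "b = H $ 1 $ 2"
  have b: "H $ 2 $ 1 = cnj b" using herm[of 2 1] by (simp add: b_def)
  have "0 < a"
    using pos[of "axis 1 1"] by (simp add: sum_2 axis_def a vec_eq_iff forall_2)
  define r where "r = a * d - (cmod b)\<^sup>2"
  have bb: "b * cnj b = of_real ((cmod b)\<^sup>2)" by (rule complex_norm_square[symmetric])
  have det: "det H = of_real r"
    by (simp add: det_2 a d b b_def[symmetric] r_def bb)
  \<comment> \<open>This vector spans the \<open>H\<close>-orthogonal complement of the first axis.
    The form takes the value \<open>a * det H\<close> on it, and \<open>a\<close> is already known
    to be positive.\<close>
  let ?v = "vector [- cnj b, of_real a] :: complex^2"
  have "?v \<noteq> 0" using \<open>0 < a\<close> by (auto simp: vec_eq_iff forall_2 vector_def)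
  then have "0 < Re (\<Sum>i\<in>UNIV. \<Sum>j\<in>UNIV. H $ i $ j * ?v $ i * cnj (?v $ j))" by (rule pos)
  also have "(\<Sum>i\<in>UNIV. \<Sum>j\<in>UNIV. H $ i $ j * ?v $ i * cnj (?v $ j)) = of_real a * det H"
    by (simp add: sum_2 a d b b_def[symmetric] det_2 algebra_simps)
  finally have "0 < a * r" by (simp add: det)
  then show ?thesis using \<open>0 < a\<close> det by (auto simp: zero_less_mult_iff)
qed

section \<open>The local computation\<close>

text \<open>Coordinate form of the data: \<open>D\<close> is the image of a chart, and
  \<open>\<Gamma>\<close> holds the connection coefficients as functions of \<open>z\<close>.
  Homogeneity is stated for nonzero factors, which preserve the slit domain.\<close>

locale berwald_domain =
  fixes F :: "(complex^2) \<times> (complex^2) \<Rightarrow> real" and D :: "(complex^2) set"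
    and \<Gamma> :: "2 \<Rightarrow> 2 \<Rightarrow> 2 \<Rightarrow> complex^2 \<Rightarrow> complex"
  assumes open_D: "open D"
    and smooth_F2: "smooth_on (D \<times> (- {0})) (\<lambda>p. (F p)\<^sup>2)"
    and F_pos: "p \<in> D \<times> (- {0}) \<Longrightarrow> 0 < F p"
    and F_homog: "(z, \<eta>) \<in> D \<times> (- {0}) \<Longrightarrow> a \<noteq> 0 \<Longrightarrow> F (z, a *s \<eta>) = cmod a * F (z, \<eta>)"
    and posdef: "p \<in> D \<times> (- {0}) \<Longrightarrow> positive_definite (g_low F p)"
    and L_conn_eq: "p \<in> D \<times> (- {0}) \<Longrightarrow> L_conn F i j k p = \<Gamma> i j k (fst p)"
begin

definition S where "S = D \<times> (- {0 :: complex^2})"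

lemma open_S: "open S"
  unfolding S_def using open_D by (intro open_Times) auto

abbreviation G :: "2 \<Rightarrow> 2 \<Rightarrow> 2 cfun" where "G i j \<equiv> \<lambda>p. g_low F p $ i $ j"

lemma G_eq: "G i j = d_eta i (d_etabar j (Lfun F))"
  by (simp add: g_low_def)

lemma G_apply: "g_low F p $ i $ j = d_eta i (d_etabar j (Lfun F)) p"
  by (simp add: g_low_def)

lemmas derivation_d_z = derivation_on_wirtinger[OF open_S, of "- \<i>" "(axis k 1, 0)" "(axis k \<i>, 0)" for k,
    folded d_z_eq_wirtinger]
lemmas derivation_d_eta = derivation_on_wirtinger[OF open_S, of "- \<i>" "(0, axis k 1)" "(0, axis k \<i>)" for k,
    folded d_eta_eq_wirtinger]
lemmas derivation_d_etabar = derivation_on_wirtinger[OF open_S, of "\<i>" "(0, axis k 1)" "(0, axis k \<i>)" for k,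
    folded d_etabar_eq_wirtinger]

lemma smooth_d:
  assumes "smooth_on S f"
  shows "smooth_on S (d_z k f)" "smooth_on S (d_eta k f)" "smooth_on S (d_etabar k f)"
  unfolding coordinate_derivative_eqs by (rule smooth_on_wirtinger[OF open_S assms])+

lemma d_commute:
  assumes "smooth_on S f" "p \<in> S"
  shows "d_eta i (d_eta j f) p = d_eta j (d_eta i f) p"
    "d_etabar i (d_eta j f) p = d_eta j (d_etabar i f) p"
    "d_z i (d_eta j f) p = d_eta j (d_z i f) p"
    "d_z i (d_etabar j f) p = d_etabar j (d_z i f) p"
  unfolding coordinate_derivative_eqs by (rule wirtinger_commute[OF open_S assms])+

lemma smooth_differentiable: "smooth_on S f \<Longrightarrow> p \<in> S \<Longrightarrow> f differentiable (at p)"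
  using smooth_on_has_derivative differentiableI by blast

lemma smooth_eta: "smooth_on S (\<lambda>p. snd p $ i)" "smooth_on S (\<lambda>p. cnj (snd p $ i))"
  by (intro smooth_on_linear open_S bounded_linear_eta bounded_linear_cnj_eta)+

lemma smooth_L: "smooth_on S (Lfun F)"
  unfolding Lfun_def[abs_def]
  by (rule smooth_on_bounded_linear[OF open_S bounded_linear_of_real]) (use smooth_F2 in \<open>simp add: S_def\<close>)

lemma smooth_G: "smooth_on S (G i j)"
  unfolding G_eq by (intro smooth_d smooth_L)

lemma G_hermitian: "p \<in> S \<Longrightarrow> G j i p = cnj (G i j p)"
  using posdef unfolding S_def positive_definite_def by blast

lemma det_pos: "p \<in> S \<Longrightarrow> \<exists>r>0. det (g_low F p) = complex_of_real r"
  using posdef positive_definite_2_det unfolding S_def by blast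

lemma det_nz: "p \<in> S \<Longrightarrow> det (g_low F p) \<noteq> 0"
  using det_pos[of p] by auto

section \<open>Euler identities\<close>

text \<open>Along the line, homogeneity multiplies \<open>Lfun F\<close> by the squared modulus of
  \<open>1 + t * a\<close>, whose derivative at \<open>t = 0\<close> is \<open>2 * Re a\<close>.
  Complex \<open>a\<close> covers both real directions of the complex ray.\<close>

lemma Lfun_derivative_radial:
  assumes p: "p \<in> S"
  shows "frechet_derivative (Lfun F) (at p) (0, a *s snd p) = 2 * Re a * Lfun F p"
proof -
  obtain z \<eta> where zn: "p = (z, \<eta>)" by (cases p)
  \<comment> \<open>Near 0 the scaling factor is nonzero, so that \<open>F_homog\<close>
    applies.\<close>
  have "eventually (\<lambda>t. t \<in> {t. 1 + of_real t * a \<noteq> 0}) (nhds (0::real))"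
    by (rule eventually_nhds_in_open)
       (auto intro!: open_Collect_neq continuous_intros)
  then have "eventually (\<lambda>t. Lfun F (p + t *\<^sub>R (0, a *s \<eta>))
      = of_real ((1 + t * Re a)\<^sup>2 + (t * Im a)\<^sup>2) * Lfun F p) (nhds (0::real))"
  proof eventually_elim
    fix t :: real assume t: "t \<in> {t. 1 + of_real t * a \<noteq> 0}"
    have "p + t *\<^sub>R (0, a *s \<eta>) = (z, (1 + of_real t * a) *s \<eta>)"
      by (simp add: zn vec_eq_iff complex_eq_iff algebra_simps)
    moreover have "(cmod (1 + of_real t * a))\<^sup>2 = (1 + t * Re a)\<^sup>2 + (t * Im a)\<^sup>2"
      by (simp add: cmod_power2)
    ultimately show "Lfun F (p + t *\<^sub>R (0, a *s \<eta>))
        = of_real ((1 + t * Re a)\<^sup>2 + (t * Im a)\<^sup>2) * Lfun F p"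
      using F_homog[of z \<eta> "1 + of_real t * a"] p t
      by (simp add: zn S_def Lfun_def power_mult_distrib flip: of_real_power)
  qed
  moreover have "((\<lambda>t. of_real ((1 + t * Re a)\<^sup>2 + (t * Im a)\<^sup>2) * Lfun F p)
      has_vector_derivative 2 * Re a * Lfun F p) (at 0)"
  proof -
    have "((\<lambda>t. (1 + t * Re a)\<^sup>2 + (t * Im a)\<^sup>2) has_real_derivative 2 * Re a) (at 0)"
      by (auto intro!: derivative_eq_intros)
    then show ?thesis
      using has_vector_derivative_mult_left[OF has_vector_derivative_of_real] by fastforce
  qed
  ultimately have "((\<lambda>t. Lfun F (p + t *\<^sub>R (0, a *s \<eta>))) has_vector_derivative 2 * Re a * Lfun F p) (at 0)"
    by (subst has_vector_derivative_cong_ev[where g = "\<lambda>t. of_real ((1 + t * Re a)\<^sup>2 + (t * Im a)\<^sup>2) * Lfun F p"])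
       (auto simp: eventually_nhds)
  then show ?thesis
    using derivative_along_line[OF smooth_differentiable[OF smooth_L p], of "(0, a *s \<eta>)"]
      vector_derivative_unique_at zn by fastforce
qed

text \<open>The radial derivative is \<open>2 * Lfun F p\<close> for \<open>a = 1\<close> and 0 for
  \<open>a = \<i>\<close>; combining them by \<open>sum_eta_d_eta\<close> leaves
  \<open>Lfun F p\<close>.\<close>

lemma euler_eta: "p \<in> S \<Longrightarrow> (\<Sum>k\<in>UNIV. snd p $ k * d_eta k (Lfun F) p) = Lfun F p"
  using Lfun_derivative_radial[of p 1] Lfun_derivative_radial[of p \<i>]
  by (subst sum_eta_d_eta) (auto intro: smooth_differentiable smooth_L)

text \<open>\<open>Lfun F\<close> is real-valued, so this is the conjugate of
  \<open>euler_eta\<close>.\<close>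

lemma euler_etabar:
  assumes p: "p \<in> S"
  shows "(\<Sum>k\<in>UNIV. cnj (snd p $ k) * d_etabar k (Lfun F) p) = Lfun F p"
proof -
  have L: "(\<lambda>p. cnj (Lfun F p)) = Lfun F" by (simp add: Lfun_def[abs_def])
  have "d_etabar k (Lfun F) p = cnj (d_eta k (Lfun F) p)" for k
    using d_etabar_cnj[OF smooth_differentiable[OF smooth_L p]] by (simp add: L)
  then show ?thesis
    using arg_cong[OF euler_eta[OF p], of cnj] fun_cong[OF L, of p] by simp
qed

text \<open>Differentiating Euler's identity by \<open>d_etabar j\<close> treats
  \<open>\<eta>\<close> as constant and turns each \<open>d_eta k (Lfun F)\<close> into an entry of
  \<open>G\<close>.\<close>

lemma G_eta:
  assumes p: "p \<in> S"
  shows "(\<Sum>k\<in>UNIV. snd p $ k * G k j p) = d_etabar j (Lfun F) p"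
proof -
  note D = derivation_d_etabar[of j]
  have "d_etabar j (Lfun F) p = d_etabar j (\<lambda>q. \<Sum>k\<in>UNIV. snd q $ k * d_eta k (Lfun F) q) p"
    by (rule derivation_cong[OF D open_S]) (auto simp: smooth_L p euler_eta)
  also have "\<dots> = (\<Sum>k\<in>UNIV. snd p $ k * d_etabar j (d_eta k (Lfun F)) p)"
    by (simp add: derivation_sum[OF D open_S] derivation_mult[OF D open_S] p
        smooth_on_mult open_S smooth_eta smooth_d smooth_L)
  finally show ?thesis by (simp add: G_apply G_eq d_commute p smooth_L)
qed

text \<open>Differentiating \<open>G_eta\<close> by \<open>d_eta m\<close>, the term from
  \<open>\<eta>\<close> reproduces \<open>G m j\<close>, so the other sum vanishes. This makes the
  fibre part of \<open>delta\<close> invisible on \<open>G\<close> after contraction with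
  \<open>\<eta>\<close>.\<close>

lemma d_eta_G_eta:
  assumes p: "p \<in> S"
  shows "(\<Sum>k\<in>UNIV. snd p $ k * d_eta m (G k j) p) = 0"
proof -
  note D = derivation_d_eta[of m]
  have "G m j p = d_eta m (d_etabar j (Lfun F)) p" by (simp add: G_apply G_eq)
  also have "\<dots> = d_eta m (\<lambda>q. \<Sum>k\<in>UNIV. snd q $ k * G k j q) p"
    by (rule derivation_cong[OF D open_S]) (auto simp: smooth_d smooth_L p G_eta)
  also have "\<dots> = (\<Sum>k\<in>UNIV. (if k = m then 1 else 0) * G k j p + snd p $ k * d_eta m (G k j) p)"
    by (simp add: derivation_sum[OF D open_S] derivation_mult[OF D open_S] p
        smooth_on_mult open_S smooth_eta smooth_G)
  also have "\<dots> = G m j p + (\<Sum>k\<in>UNIV. snd p $ k * d_eta m (G k j) p)"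
    using exhaust_2[of m] by (auto simp: sum_2)
  finally show ?thesis by simp
qed

lemma G_eta_cnj_eta:
  "p \<in> S \<Longrightarrow> (\<Sum>j\<in>UNIV. \<Sum>k\<in>UNIV. G j k p * snd p $ j * cnj (snd p $ k)) = Lfun F p"
  using euler_etabar[of p] by (simp add: G_eta[symmetric] sum_2 algebra_simps)

section \<open>The inverse metric and smoothness of the connection\<close>

lemma g_up_g_low:
  assumes "p \<in> S"
  shows "(\<Sum>i\<in>UNIV. g_up F p $ l $ i * G i n p) = (if l = n then 1 else 0)"
proof -
  have "invertible (g_low F p)" using det_nz[OF assms] invertible_det_nz by blast
  then have "g_up F p ** g_low F p = mat 1"
    unfolding g_up_def matrix_inv_def invertible_def
    using someI_ex[of "\<lambda>B. g_low F p ** B = mat 1 \<and> B ** g_low F p = mat 1"] by blast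
  then have "(g_up F p ** g_low F p) $ l $ n = (mat 1 :: complex^2^2) $ l $ n" by simp
  then show ?thesis by (simp add: matrix_matrix_mult_def mat_def)
qed

lemma smooth_det: "smooth_on S (\<lambda>p. det (g_low F p))"
  unfolding det_2 by (intro smooth_on_diff smooth_on_mult open_S smooth_G)

lemma smooth_g_up: "smooth_on S (\<lambda>p. g_up F p $ l $ i)"
proof -
  \<comment> \<open>The adjugate matrix: in the type \<open>2\<close>, \<open>3 - i\<close>
    exchanges the two indices. Dividing by the determinant exhibits \<open>g_up\<close> as a
    quotient of smooth functions.\<close>
  define A where "A p = (\<chi> i j. if i = j then G (3 - i) (3 - i) p else - G i j p)" for p
  have "(\<forall>i j. smooth_on S (\<lambda>p. A p $ i $ j))"
    unfolding A_def forall_2 by (simp add: smooth_G smooth_on_minus open_S)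
  then have sm: "smooth_on S (\<lambda>p. A p $ l $ i / det (g_low F p))"
    by (intro smooth_on_divide open_S smooth_det det_nz) auto
  have "A p $ l $ i / det (g_low F p) = g_up F p $ l $ i" if p: "p \<in> S" for p
  proof -
    have 1: "A p $ 1 $ 1 = G 2 2 p" "A p $ 2 $ 2 = G 1 1 p" "A p $ 1 $ 2 = - G 1 2 p" "A p $ 2 $ 1 = - G 2 1 p"
      by (simp_all add: A_def)
    have GA: "(\<Sum>i\<in>UNIV. G j i p * A p $ i $ m) = (if j = m then det (g_low F p) else 0)" for j m
      using exhaust_2[of m] exhaust_2[of j] by (auto simp: sum_2 1 det_2 algebra_simps)
    then have "g_up F p $ l $ i * det (g_low F p) = (\<Sum>j\<in>UNIV. g_up F p $ l $ j * (\<Sum>n\<in>UNIV. G j n p * A p $ n $ i))"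
      unfolding GA using exhaust_2[of i] by (auto simp: sum_2)
    also have "\<dots> = (\<Sum>n\<in>UNIV. (\<Sum>j\<in>UNIV. g_up F p $ l $ j * G j n p) * A p $ n $ i)"
      unfolding sum_2 by (simp only: distrib_left distrib_right mult.assoc add_ac)
    also have "\<dots> = A p $ l $ i"
      unfolding g_up_g_low[OF p] using exhaust_2[of l] by (auto simp: sum_2)
    finally show ?thesis using det_nz[OF p] by (simp add: field_simps)
  qed
  then show ?thesis by (rule smooth_on_cong[OF open_S _ sm])
qed

lemma smooth_N: "smooth_on S (N_conn F k j)"
  unfolding N_conn_def[abs_def]
  by (intro smooth_on_sum smooth_on_mult open_S smooth_g_up smooth_d smooth_G smooth_eta)

lemma smooth_delta: "smooth_on S f \<Longrightarrow> smooth_on S (delta F k f)"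
  unfolding delta_def[abs_def]
  by (intro smooth_on_diff smooth_on_sum smooth_on_mult open_S smooth_N smooth_d)

lemma derivation_delta: "derivation_on S (delta F k)"
  using derivation_on_lincomb[of S "d_z k" UNIV d_eta "\<lambda>_. 1" "\<lambda>j p. - N_conn F j k p"]
    derivation_d_z derivation_d_eta
  by (simp add: delta_def[abs_def] sum_negf)

lemma smooth_L_conn: "smooth_on S (L_conn F i j k)"
  unfolding L_conn_def[abs_def]
  by (intro smooth_on_sum smooth_on_mult open_S smooth_g_up smooth_delta smooth_G)

section \<open>The connection in the Berwald case\<close>

text \<open>The Berwald condition enters here: on \<open>S\<close> the coefficients depend on
  \<open>z\<close> alone, so they are constant along the fibres.\<close>

lemma d_L_conn:
  assumes p: "p \<in> S"
  shows "d_eta m (L_conn F i j k) p = 0" "d_etabar m (L_conn F i j k) p = 0"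
proof -
  have "frechet_derivative (L_conn F i j k) (at p) (0, v) = 0" for v
    by (rule frechet_derivative_eta_const[OF open_S p smooth_differentiable[OF smooth_L_conn p],
          where h = "\<Gamma> i j k"]) (simp add: L_conn_eq S_def)
  then show "d_eta m (L_conn F i j k) p = 0" "d_etabar m (L_conn F i j k) p = 0"
    by (simp_all add: d_eta_def d_etabar_def)
qed

text \<open>Contracted with \<open>\<eta>\<close>, \<open>delta\<close> and \<open>d_z\<close> agree
  on \<open>G\<close>, as the fibre terms vanish by \<open>d_eta_G_eta\<close>. Raising the index
  gives \<open>L_conn\<close> on one side and \<open>N_conn\<close> on the other.\<close>

lemma N_conn_eq:
  assumes p: "p \<in> S"
  shows "N_conn F i k p = (\<Sum>j\<in>UNIV. L_conn F i j k p * snd p $ j)"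
proof -
  have 0: "(\<Sum>j\<in>UNIV. snd p $ j * d_eta m (G j l) p) = 0" for m l
    by (rule d_eta_G_eta[OF p])
  have "(\<Sum>j\<in>UNIV. delta F k (G j l) p * snd p $ j)
      = (\<Sum>j\<in>UNIV. d_z k (G j l) p * snd p $ j)" for l
    using 0[of 1 l] 0[of 2 l] unfolding delta_def sum_2 by algebra
  then have 1: "(\<Sum>j\<in>UNIV. g_up F p $ l $ i * delta F k (G j l) p * snd p $ j)
      = (\<Sum>j\<in>UNIV. g_up F p $ l $ i * d_z k (G j l) p * snd p $ j)" for l
    by (simp add: mult.assoc flip: sum_distrib_left)
  have "(\<Sum>j\<in>UNIV. L_conn F i j k p * snd p $ j)
      = (\<Sum>l\<in>UNIV. \<Sum>j\<in>UNIV. g_up F p $ l $ i * delta F k (G j l) p * snd p $ j)"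
    unfolding L_conn_def sum_distrib_right by (rule sum.swap)
  then show ?thesis by (simp add: 1 N_conn_def)
qed

text \<open>Multiplying the definition of \<open>L_conn\<close> by the metric cancels
  \<open>g_up\<close>. The conjugate index \<open>n\<close> contributes no connection term.\<close>

lemma delta_G:
  assumes p: "p \<in> S"
  shows "delta F k (G j n) p = (\<Sum>i\<in>UNIV. L_conn F i j k p * G i n p)"
proof -
  have "(\<Sum>i\<in>UNIV. L_conn F i j k p * G i n p)
     = (\<Sum>l\<in>UNIV. delta F k (G j l) p * (\<Sum>i\<in>UNIV. g_up F p $ l $ i * G i n p))"
    unfolding L_conn_def sum_2 by (simp add: algebra_simps)
  then show ?thesis
    unfolding g_up_g_low[OF p] using exhaust_2[of n] by (auto simp: sum_2)
qed

text \<open>By \<open>N_conn_eq\<close>, \<open>N_conn\<close> is linear in \<open>\<eta>\<close>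
  with coefficients constant along the fibres, hence holomorphic there.\<close>

lemma d_N_conn:
  assumes p: "p \<in> S"
  shows "d_eta m (N_conn F i k) p = L_conn F i m k p" "d_etabar m (N_conn F i k) p = 0"
proof -
  have e: "X (N_conn F i k) p = X (\<lambda>q. \<Sum>j\<in>UNIV. L_conn F i j k q * snd q $ j) p"
    if "derivation_on S X" for X
    by (rule derivation_cong[OF that open_S smooth_N _ p]) (simp add: N_conn_eq)
  show "d_eta m (N_conn F i k) p = L_conn F i m k p"
    unfolding e[OF derivation_d_eta]
    by (simp add: derivation_sum[OF derivation_d_eta open_S] derivation_mult[OF derivation_d_eta open_S]
        smooth_on_mult open_S smooth_L_conn smooth_eta d_L_conn p)
       (use exhaust_2[of m] in \<open>auto simp: sum_2\<close>)
  show "d_etabar m (N_conn F i k) p = 0"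
    unfolding e[OF derivation_d_etabar]
    by (simp add: derivation_sum[OF derivation_d_etabar open_S] derivation_mult[OF derivation_d_etabar open_S]
        smooth_on_mult open_S smooth_L_conn smooth_eta d_L_conn p)
qed

text \<open>The commutator consists of derivatives of \<open>N_conn\<close> by
  \<open>d_etabar s\<close>, which vanish.\<close>

lemma delta_d_etabar:
  assumes f: "smooth_on S f" and p: "p \<in> S"
  shows "delta F k (d_etabar s f) p = d_etabar s (delta F k f) p"
proof -
  note D = derivation_d_etabar[of s]
  have "d_etabar s (delta F k f) p = d_etabar s (d_z k f) p
      - (\<Sum>j\<in>UNIV. N_conn F j k p * d_etabar s (d_eta j f) p)"
    unfolding delta_def[abs_def]
    by (simp add: derivation_diff[OF D open_S] derivation_sum[OF D open_S] derivation_mult[OF D open_S]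
        smooth_on_mult smooth_on_sum open_S smooth_N smooth_d f p d_N_conn)
  then show ?thesis by (simp add: delta_def d_commute f p)
qed

text \<open>Here the derivatives of \<open>N_conn\<close> survive in the commutator, and they are
  the coefficients \<open>L_conn\<close>.\<close>

lemma delta_d_eta:
  assumes f: "smooth_on S f" and p: "p \<in> S"
  shows "delta F k (d_eta n f) p = d_eta n (delta F k f) p + (\<Sum>j\<in>UNIV. L_conn F j n k p * d_eta j f p)"
proof -
  note D = derivation_d_eta[of n]
  have "d_eta n (delta F k f) p = d_eta n (d_z k f) p
      - (\<Sum>j\<in>UNIV. L_conn F j n k p * d_eta j f p + N_conn F j k p * d_eta n (d_eta j f) p)"
    unfolding delta_def[abs_def]
    by (simp add: derivation_diff[OF D open_S] derivation_sum[OF D open_S] derivation_mult[OF D open_S]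
        smooth_on_mult smooth_on_sum open_S smooth_N smooth_d f p d_N_conn)
  then show ?thesis by (simp add: delta_def d_commute(3) d_commute(1)[of f p n] f p sum.distrib)
qed

section \<open>Horizontal derivatives of the length, the determinant and the frame\<close>

text \<open>The trace \<open>\<tau>\<^sub>k\<close> of the overview, by which \<open>delta\<close>
  rescales the determinant of the metric.\<close>

definition trace_conn :: "2 \<Rightarrow> 2 cfun" where
  "trace_conn k p = (\<Sum>i\<in>UNIV. L_conn F i i k p)"

lemma smooth_trace_conn: "smooth_on S (trace_conn k)"
  unfolding trace_conn_def[abs_def] by (intro smooth_on_sum open_S smooth_L_conn)

lemma d_etabar_trace_conn: "p \<in> S \<Longrightarrow> d_etabar s (trace_conn k) p = 0"
  unfolding trace_conn_def[abs_def]
  by (simp add: derivation_sum[OF derivation_d_etabar open_S] smooth_L_conn d_L_conn)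

lemma delta_eta:
  "p \<in> S \<Longrightarrow> delta F k (\<lambda>q. snd q $ i) p = - (\<Sum>j\<in>UNIV. L_conn F i j k p * snd p $ j)"
  "delta F k (\<lambda>q. cnj (snd q $ i)) p = 0"
  using exhaust_2[of i] N_conn_eq[of p _ k] by (auto simp: delta_def sum_2)

lemma F_nz: "p \<in> S \<Longrightarrow> complex_of_real (F p) \<noteq> 0"
  using F_pos[of p] by (simp add: S_def)

lemma F_nz': "p \<in> S \<Longrightarrow> F p \<noteq> 0"
  using F_nz by simp

lemma Lfun_pos: "p \<in> S \<Longrightarrow> Lfun F p \<notin> \<real>\<^sub>\<le>\<^sub>0"
  using F_pos[of p] by (simp add: S_def Lfun_def complex_nonpos_Reals_iff flip: of_real_power)

lemma smooth_F: "smooth_on S (\<lambda>p. complex_of_real (F p))"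
proof (rule smooth_on_cong[OF open_S])
  show "smooth_on S (\<lambda>p. csqrt (Lfun F p))"
    by (intro smooth_on_csqrt open_S smooth_L Lfun_pos)
  show "csqrt (Lfun F p) = complex_of_real (F p)" if "p \<in> S" for p
    using F_pos[of p] that by (simp add: Lfun_def S_def csqrt_of_real_nonneg flip: of_real_power)
qed

lemmas derivation_delta_simps =
  derivation_sum[OF derivation_delta open_S] derivation_mult[OF derivation_delta open_S]
  derivation_divide[OF derivation_delta open_S] derivation_minus[OF derivation_delta open_S]
  derivation_diff[OF derivation_delta open_S]

text \<open>With \<open>Lfun F\<close> written as \<open>G\<close> contracted with
  \<open>\<eta>\<close> and its conjugate, the connection term of \<open>G\<close> cancels that of
  \<open>\<eta>\<close>, while the conjugate of \<open>\<eta>\<close> is parallel.\<close>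

lemma delta_Lfun:
  assumes p: "p \<in> S"
  shows "delta F k (Lfun F) p = 0"
proof -
  have "delta F k (Lfun F) p
      = delta F k (\<lambda>p. \<Sum>j\<in>UNIV. \<Sum>l\<in>UNIV. G j l p * snd p $ j * cnj (snd p $ l)) p"
    by (rule derivation_cong[OF derivation_delta open_S smooth_L _ p]) (simp add: G_eta_cnj_eta)
  also have "\<dots> = 0"
    by (simp add: derivation_delta_simps smooth_on_mult smooth_on_sum open_S smooth_G smooth_eta p
        delta_G delta_eta)
       (simp add: sum_2 algebra_simps)
  finally show ?thesis .
qed

lemma delta_F:
  assumes p: "p \<in> S"
  shows "delta F k (\<lambda>p. complex_of_real (F p)) p = 0"
  using derivation_square_root[OF derivation_delta open_S smooth_F _ p F_nz[OF p], of "Lfun F" k]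
  by (simp add: delta_Lfun p Lfun_def power2_eq_square)

lemma l_low_eq: "l_low F i = (\<lambda>p. (\<Sum>j\<in>UNIV. G i j p * cnj (snd p $ j)) / of_real (F p))"
  by (simp add: l_low_def[abs_def])

lemma smooth_l_low: "smooth_on S (l_low F i)"
  unfolding l_low_eq
  by (intro smooth_on_divide smooth_on_sum smooth_on_mult open_S smooth_G smooth_eta smooth_F F_nz)

text \<open>\<open>F\<close> and the conjugate of \<open>\<eta>\<close> are parallel, so only the
  row index of \<open>G\<close> contributes.\<close>

lemma delta_l_low:
  assumes p: "p \<in> S"
  shows "delta F k (l_low F i) p = (\<Sum>j\<in>UNIV. L_conn F j i k p * l_low F j p)"
  unfolding l_low_eq
  by (simp add: derivation_delta_simps smooth_on_mult smooth_on_sum open_S smooth_G smooth_eta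
      smooth_F F_nz' delta_F delta_G delta_eta p)
     (simp add: sum_2 add_divide_distrib algebra_simps)

lemma cnj_l_low: "p \<in> S \<Longrightarrow> cnj (l_low F i p) = (\<Sum>j\<in>UNIV. G j i p * snd p $ j) / of_real (F p)"
  by (simp add: l_low_def flip: G_hermitian)

text \<open>\<open>delta\<close> does not commute with conjugation, so hermitian symmetry first
  rewrites the conjugate as \<open>G\<close> contracted with \<open>\<eta>\<close>, divided by
  \<open>F\<close>. The connection terms of \<open>G\<close> and \<open>\<eta>\<close> then
  cancel.\<close>

lemma delta_cnj_l_low:
  assumes p: "p \<in> S"
  shows "delta F k (\<lambda>p. cnj (l_low F i p)) p = 0"
proof -
  have "delta F k (\<lambda>p. cnj (l_low F i p)) p
      = delta F k (\<lambda>p. (\<Sum>j\<in>UNIV. G j i p * snd p $ j) / of_real (F p)) p"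
    by (rule derivation_cong[OF derivation_delta open_S _ _ p])
       (auto intro: smooth_on_cnj open_S smooth_l_low simp: cnj_l_low)
  also have "\<dots> = 0"
    by (simp add: derivation_delta_simps smooth_on_mult smooth_on_sum open_S smooth_G smooth_eta
        smooth_F F_nz' delta_F delta_G delta_eta p)
       (simp add: sum_2 algebra_simps)
  finally show ?thesis .
qed

lemma sqrt_g_square: "sqrt_g F p * sqrt_g F p = det (g_low F p)"
  by (simp add: sqrt_g_def flip: power2_eq_square)

lemma sqrt_g_nz: "p \<in> S \<Longrightarrow> sqrt_g F p \<noteq> 0"
  using det_nz[of p] by (simp add: sqrt_g_def)

lemma cnj_sqrt_g: "p \<in> S \<Longrightarrow> cnj (sqrt_g F p) = sqrt_g F p"
  using det_pos[of p] by (auto simp: sqrt_g_def csqrt_of_real_nonneg)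

lemma smooth_sqrt_g: "smooth_on S (sqrt_g F)"
  unfolding sqrt_g_def[abs_def]
  by (intro smooth_on_csqrt open_S smooth_det) (auto dest!: det_pos)

text \<open>\<open>delta\<close> acts on the rows of \<open>G\<close> through a matrix, so the
  determinant is multiplied by the trace of that matrix; the root halves this weight.\<close>

lemma delta_sqrt_g:
  assumes p: "p \<in> S"
  shows "delta F k (sqrt_g F) p = trace_conn k p / 2 * sqrt_g F p"
proof -
  have "delta F k (\<lambda>p. det (g_low F p)) p = trace_conn k p * det (g_low F p)"
    unfolding det_2 trace_conn_def
    by (simp add: derivation_delta_simps smooth_on_mult open_S smooth_G delta_G p sum_2 algebra_simps)
  then have "delta F k (sqrt_g F) p = trace_conn k p * det (g_low F p) / (2 * sqrt_g F p)"
    using derivation_square_root[OF derivation_delta open_S smooth_sqrt_g _ p sqrt_g_nz[OF p]]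
      sqrt_g_square by metis
  then show ?thesis
    using sqrt_g_nz[OF p] by (simp flip: sqrt_g_square)
qed

lemma m_up_eq:
  "m_up F 1 = (\<lambda>p. - l_low F 2 p / sqrt_g F p)" "m_up F 2 = (\<lambda>p. l_low F 1 p / sqrt_g F p)"
  by (auto simp: m_up_def)

lemma smooth_m_up: "smooth_on S (m_up F i)"
  using exhaust_2[of i]
  by (auto simp: m_up_eq intro!: smooth_on_divide smooth_on_minus open_S smooth_l_low smooth_sqrt_g sqrt_g_nz)

text \<open>\<open>m_up\<close> is \<open>l_low\<close> with its indices exchanged and one sign
  changed, divided by \<open>sqrt_g\<close>. In dimension two the exchange turns the action on
  covectors into the trace minus the action on vectors; the division removes half of the
  trace.\<close>

lemma delta_m_up:
  assumes p: "p \<in> S"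
  shows "delta F k (m_up F i) p = trace_conn k p / 2 * m_up F i p - (\<Sum>j\<in>UNIV. L_conn F i j k p * m_up F j p)"
proof -
  define x where "x i = l_low F i p / sqrt_g F p" for i
  have d: "delta F k (\<lambda>p. l_low F i p / sqrt_g F p) p
      = (\<Sum>j\<in>UNIV. L_conn F j i k p * x j) - trace_conn k p / 2 * x i" for i
    using sqrt_g_nz[OF p] unfolding x_def
    by (simp add: derivation_divide[OF derivation_delta open_S] smooth_l_low smooth_sqrt_g sqrt_g_nz p
        delta_sqrt_g delta_l_low diff_divide_distrib sum_divide_distrib)
  have m: "m_up F 1 p = - x 2" "m_up F 2 p = x 1"
    by (simp_all add: m_up_eq x_def)
  have 1: "m_up F 1 = (\<lambda>p. - (l_low F 2 p / sqrt_g F p))" by (simp add: m_up_eq)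
  have "delta F k (m_up F 1) p = - delta F k (\<lambda>p. l_low F 2 p / sqrt_g F p) p"
    unfolding 1
    by (intro derivation_minus[OF derivation_delta open_S] smooth_on_divide open_S smooth_l_low
        smooth_sqrt_g sqrt_g_nz p)
  then have "delta F k (m_up F 1) p = trace_conn k p / 2 * m_up F 1 p - (\<Sum>j\<in>UNIV. L_conn F 1 j k p * m_up F j p)"
    unfolding d sum_2 m trace_conn_def by (simp add: algebra_simps add_divide_distrib)
  moreover have "delta F k (m_up F 2) p = delta F k (\<lambda>p. l_low F 1 p / sqrt_g F p) p"
    by (simp add: m_up_eq(2))
  then have "delta F k (m_up F 2) p = trace_conn k p / 2 * m_up F 2 p - (\<Sum>j\<in>UNIV. L_conn F 2 j k p * m_up F j p)"
    unfolding d sum_2 m trace_conn_def by (simp add: algebra_simps add_divide_distrib)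
  ultimately show ?thesis using exhaust_2[of i] by (elim disjE) simp_all
qed

lemma cnj_m_up:
  assumes "p \<in> S"
  shows "cnj (m_up F 1 p) = - cnj (l_low F 2 p) / sqrt_g F p" "cnj (m_up F 2 p) = cnj (l_low F 1 p) / sqrt_g F p"
  using cnj_sqrt_g[OF assms] by (simp_all add: m_up_eq)

lemma smooth_cnj_m_up: "smooth_on S (\<lambda>p. cnj (m_up F i p))"
  by (intro smooth_on_cnj open_S smooth_m_up)

text \<open>\<open>sqrt_g\<close> is real and the conjugate of \<open>l_low\<close> is parallel, so
  only the weight of \<open>1 / sqrt_g\<close> remains.\<close>

lemma delta_cnj_m_up:
  assumes p: "p \<in> S"
  shows "delta F k (\<lambda>p. cnj (m_up F i p)) p = - (trace_conn k p / 2 * cnj (m_up F i p))"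
proof -
  note s = derivation_delta_simps smooth_on_minus smooth_on_divide smooth_on_cnj open_S smooth_l_low smooth_sqrt_g sqrt_g_nz p
      delta_cnj_l_low delta_sqrt_g
  have "delta F k (\<lambda>p. cnj (m_up F 1 p)) p = delta F k (\<lambda>p. - cnj (l_low F 2 p) / sqrt_g F p) p"
    "delta F k (\<lambda>p. cnj (m_up F 2 p)) p = delta F k (\<lambda>p. cnj (l_low F 1 p) / sqrt_g F p) p"
    by (rule derivation_cong[OF derivation_delta open_S smooth_cnj_m_up _ p]; simp add: cnj_m_up)+
  moreover have "delta F k (\<lambda>p. - cnj (l_low F 2 p) / sqrt_g F p) p = - (trace_conn k p / 2 * cnj (m_up F 1 p))"
    "delta F k (\<lambda>p. cnj (l_low F 1 p) / sqrt_g F p) p = - (trace_conn k p / 2 * cnj (m_up F 2 p))"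
    using sqrt_g_nz[OF p] by (simp_all add: s cnj_m_up field_simps)
  ultimately show ?thesis using exhaust_2[of i] by (elim disjE) simp_all
qed

section \<open>The scalar \<open>B\<close> and the vertical curvature invariant\<close>

text \<open>Once \<open>sqrt_g\<close> is cleared, the conjugates of \<open>l_low\<close> combine
  into the determinant of \<open>G\<close> times a component of \<open>\<eta>\<close>. The covector
  is thus the metric dual of \<open>m_up\<close>, which lets it be eliminated from
  \<open>B\<close>.\<close>

lemma m_low_eq:
  assumes p: "p \<in> S"
  shows "m_low F h p = (\<Sum>l\<in>UNIV. G h l p * cnj (m_up F l p))"
proof -
  have "sqrt_g F p * m_low F h p = sqrt_g F p * (\<Sum>l\<in>UNIV. G h l p * cnj (m_up F l p))"
  proof -
    have "sqrt_g F p * (\<Sum>l\<in>UNIV. G h l p * cnj (m_up F l p))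
        = G h 2 p * cnj (l_low F 1 p) - G h 1 p * cnj (l_low F 2 p)"
      using sqrt_g_nz[OF p] by (simp add: sum_2 cnj_m_up[OF p] field_simps)
    also have "\<dots> = (G h 2 p * (\<Sum>j\<in>UNIV. G j 1 p * snd p $ j)
        - G h 1 p * (\<Sum>j\<in>UNIV. G j 2 p * snd p $ j)) / of_real (F p)"
      by (simp add: cnj_l_low[OF p] diff_divide_distrib)
    also have "\<dots> = (if h = 1 then - (det (g_low F p) * snd p $ 2) else det (g_low F p) * snd p $ 1) / of_real (F p)"
      using exhaust_2[of h] by (auto simp: det_2 sum_2 algebra_simps)
    also have "\<dots> = sqrt_g F p * m_low F h p"
      by (simp add: m_low_def l_up_def flip: sqrt_g_square)
    finally show ?thesis by (rule sym)
  qed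
  then show ?thesis using sqrt_g_nz[OF p] by simp
qed

text \<open>Lowering the index of \<open>C\<close> removes the inverse matrix from \<open>B\<close>, so that \<open>B\<close> is a contraction of
  derivatives of \<open>g\<close> with the frame.\<close>

lemma B_inv_eq:
  assumes p: "p \<in> S"
  shows "B_inv F p = (\<Sum>l\<in>UNIV. \<Sum>k\<in>UNIV. \<Sum>j\<in>UNIV.
     cnj (m_up F l p) * m_up F k p * m_up F j p * d_eta k (G j l) p)"
proof -
  have "(\<Sum>h\<in>UNIV. m_low F h p * C_conn F h j k p) = (\<Sum>l\<in>UNIV. cnj (m_up F l p) * d_eta k (G j l) p)" for j k
  proof -
    have "(\<Sum>h\<in>UNIV. m_low F h p * C_conn F h j k p) =
      (\<Sum>n\<in>UNIV. \<Sum>l\<in>UNIV. d_eta k (G j n) p * cnj (m_up F l p) * (\<Sum>h\<in>UNIV. g_up F p $ n $ h * G h l p))"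
      unfolding m_low_eq[OF p] C_conn_def sum_2 by (simp add: algebra_simps)
    then show ?thesis
      unfolding g_up_g_low[OF p] sum_2 by (simp add: mult.commute)
  qed
  from this[unfolded sum_2] have 1: "m_low F 1 p * C_conn F 1 j k p + m_low F 2 p * C_conn F 2 j k p
      = cnj (m_up F 1 p) * d_eta k (G j 1) p + cnj (m_up F 2 p) * d_eta k (G j 2) p" for j k .
  have "B_inv F p = (\<Sum>k\<in>UNIV. \<Sum>j\<in>UNIV. m_up F k p * m_up F j p *
      (m_low F 1 p * C_conn F 1 j k p + m_low F 2 p * C_conn F 2 j k p))"
    unfolding B_inv_def sum_2 by (simp add: algebra_simps)
  then show ?thesis
    unfolding 1 unfolding sum_2 by (simp add: algebra_simps)
qed

lemma smooth_B: "smooth_on S (B_inv F)"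
  by (rule smooth_on_cong[OF open_S B_inv_eq[symmetric]])
     (auto intro!: smooth_on_sum smooth_on_mult open_S smooth_cnj_m_up smooth_m_up smooth_d smooth_G)

text \<open>The sum for the index \<open>j\<close> comes from \<open>delta_G\<close>, whose
  coefficients pass through \<open>d_eta n\<close>; the sum for \<open>n\<close> is the commutator
  of \<open>delta_d_eta\<close>.\<close>

lemma delta_d_eta_G:
  assumes p: "p \<in> S"
  shows "delta F k (d_eta n (G j l)) p
    = (\<Sum>i\<in>UNIV. L_conn F i j k p * d_eta n (G i l) p) + (\<Sum>i\<in>UNIV. L_conn F i n k p * d_eta i (G j l) p)"
proof -
  note D = derivation_d_eta[of n]
  have "d_eta n (delta F k (G j l)) p = d_eta n (\<lambda>q. \<Sum>i\<in>UNIV. L_conn F i j k q * G i l q) p"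
    by (rule derivation_cong[OF D open_S smooth_delta[OF smooth_G] _ p]) (rule delta_G)
  also have "\<dots> = (\<Sum>i\<in>UNIV. L_conn F i j k p * d_eta n (G i l) p)"
    by (simp add: derivation_sum[OF D open_S] derivation_mult[OF D open_S] smooth_on_mult open_S
        smooth_L_conn smooth_G d_L_conn p)
  finally show ?thesis by (simp add: delta_d_eta smooth_G p)
qed

text \<open>\<open>delta\<close> commutes with \<open>d_etabar n\<close>, so the connection sees the
  index \<open>j\<close> alone.\<close>

lemma delta_d_etabar_G:
  assumes p: "p \<in> S"
  shows "delta F k (d_etabar n (G j l)) p = (\<Sum>i\<in>UNIV. L_conn F i j k p * d_etabar n (G i l) p)"
proof -
  note D = derivation_d_etabar[of n]
  have "d_etabar n (delta F k (G j l)) p = d_etabar n (\<lambda>q. \<Sum>i\<in>UNIV. L_conn F i j k q * G i l q) p"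
    by (rule derivation_cong[OF D open_S smooth_delta[OF smooth_G] _ p]) (rule delta_G)
  also have "\<dots> = (\<Sum>i\<in>UNIV. L_conn F i j k p * d_etabar n (G i l) p)"
    by (simp add: derivation_sum[OF D open_S] derivation_mult[OF D open_S] smooth_on_mult open_S
        smooth_L_conn smooth_G d_L_conn p)
  finally show ?thesis by (simp add: delta_d_etabar smooth_G p)
qed

text \<open>The connection terms of the two factors \<open>m_up\<close> cancel those of
  \<open>d_eta n (G j l)\<close>. The weights are \<open>\<tau> / 2\<close> from each of these
  factors and \<open>- \<tau> / 2\<close> from the conjugate one.\<close>

lemma delta_B:
  assumes p: "p \<in> S"
  shows "delta F k (B_inv F) p = trace_conn k p / 2 * B_inv F p"
proof -
  have "delta F k (B_inv F) p = delta F k (\<lambda>p. \<Sum>l\<in>UNIV. \<Sum>n\<in>UNIV. \<Sum>j\<in>UNIV.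
     cnj (m_up F l p) * m_up F n p * m_up F j p * d_eta n (G j l) p) p"
    by (rule derivation_cong[OF derivation_delta open_S smooth_B _ p]) (rule B_inv_eq)
  also have "\<dots> = trace_conn k p / 2 * B_inv F p"
    unfolding B_inv_eq[OF p]
    by (simp add: derivation_delta_simps smooth_on_mult smooth_on_sum open_S smooth_m_up smooth_cnj_m_up
        smooth_d smooth_G p delta_m_up delta_cnj_m_up delta_d_eta_G)
       (simp add: sum_2 field_simps)
  finally show ?thesis .
qed

text \<open>Hermitian symmetry of \<open>G\<close> removes the conjugation from the differentiated
  metric, leaving factors whose \<open>delta\<close> is known.\<close>

lemma cnj_B_inv_eq:
  assumes p: "p \<in> S"
  shows "cnj (B_inv F p) = (\<Sum>l\<in>UNIV. \<Sum>k\<in>UNIV. \<Sum>j\<in>UNIV.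
     m_up F l p * cnj (m_up F k p) * cnj (m_up F j p) * d_etabar k (G l j) p)"
proof -
  have "cnj (d_eta k (G j l) p) = d_etabar k (G l j) p" for j k l
  proof -
    have "d_etabar k (G l j) p = d_etabar k (\<lambda>q. cnj (G j l q)) p"
      by (rule derivation_cong[OF derivation_d_etabar open_S smooth_G _ p]) (rule G_hermitian)
    then show ?thesis by (simp add: d_etabar_cnj smooth_differentiable[OF smooth_G p])
  qed
  then show ?thesis by (simp add: B_inv_eq[OF p])
qed

text \<open>One \<open>m_up\<close> has weight \<open>\<tau> / 2\<close> and two conjugates have
  \<open>- \<tau> / 2\<close> each; the connection term of \<open>m_up\<close> cancels that of the
  differentiated metric.\<close>

lemma delta_cnj_B:
  assumes p: "p \<in> S"
  shows "delta F k (\<lambda>p. cnj (B_inv F p)) p = - (trace_conn k p / 2 * cnj (B_inv F p))"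
proof -
  have "delta F k (\<lambda>p. cnj (B_inv F p)) p = delta F k (\<lambda>p. \<Sum>l\<in>UNIV. \<Sum>n\<in>UNIV. \<Sum>j\<in>UNIV.
     m_up F l p * cnj (m_up F n p) * cnj (m_up F j p) * d_etabar n (G l j) p) p"
    by (rule derivation_cong[OF derivation_delta open_S _ _ p])
       (auto simp: cnj_B_inv_eq intro!: smooth_on_cnj open_S smooth_B)
  also have "\<dots> = - (trace_conn k p / 2 * cnj (B_inv F p))"
    unfolding cnj_B_inv_eq[OF p]
    by (simp add: derivation_delta_simps smooth_on_mult smooth_on_sum open_S smooth_m_up smooth_cnj_m_up
        smooth_d smooth_G p delta_m_up delta_cnj_m_up delta_d_etabar_G)
       (simp add: sum_2 field_simps)
  finally show ?thesis .
qed

text \<open>The weight in \<open>delta_B\<close> is annihilated by \<open>d_etabar s\<close>, which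
  commutes with \<open>delta\<close>, so \<open>B\<close> and this derivative scale alike.\<close>

lemma delta_d_etabar_B:
  assumes p: "p \<in> S"
  shows "delta F k (d_etabar s (B_inv F)) p = trace_conn k p / 2 * d_etabar s (B_inv F) p"
proof -
  note D = derivation_d_etabar[of s]
  have "d_etabar s (delta F k (B_inv F)) p = d_etabar s (\<lambda>q. (1/2) * (trace_conn k q * B_inv F q)) p"
    by (rule derivation_cong[OF D open_S smooth_delta[OF smooth_B] _ p]) (simp add: delta_B)
  also have "\<dots> = trace_conn k p / 2 * d_etabar s (B_inv F) p"
    unfolding derivation_cmult[OF D open_S smooth_on_mult[OF open_S smooth_trace_conn smooth_B] p]
    by (simp add: derivation_mult[OF D open_S] smooth_trace_conn smooth_B d_etabar_trace_conn p)
  finally show ?thesis by (simp add: delta_d_etabar smooth_B p)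
qed

lemma delta_I_inv:
  assumes p: "p \<in> S"
  shows "delta F k (I_inv F) p = 0"
proof -
  have "I_inv F = (\<lambda>q. - (\<Sum>s\<in>UNIV. cnj (m_up F s q) * d_etabar s (B_inv F) q)
      - B_inv F q * cnj (B_inv F q) / 2)"
    by (simp add: I_inv_def[abs_def])
  then show ?thesis
    by (simp add: derivation_delta_simps smooth_on_mult smooth_on_sum smooth_on_minus smooth_on_divide smooth_on_const
        smooth_on_cnj derivation_const[OF derivation_delta open_S]
        open_S smooth_cnj_m_up smooth_B smooth_d p delta_cnj_m_up delta_B delta_cnj_B delta_d_etabar_B)
qed

end

section \<open>Coordinates on the tangent bundle\<close>

context
  fixes X :: "'a topology" and A :: "('a, 'n::finite) chart set"
  assumes M: "complex_manifold X A"
begin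

lemma manifold_chart: "c \<in> A \<Longrightarrow> is_chart X c"
  using M by (simp add: complex_manifold_def)

lemma chart_subset: "c \<in> A \<Longrightarrow> fst c \<subseteq> topspace X"
  using manifold_chart unfolding is_chart_def by (blast dest: openin_subset)

lemma inj_on_chart:
  assumes "c \<in> A"
  shows "inj_on (snd c) (fst c)"
proof -
  have "homeomorphic_map (subtopology X (fst c)) (top_of_set (snd c ` fst c)) (snd c)"
    using manifold_chart[OF assms] by (simp add: is_chart_def)
  from homeomorphic_imp_injective_map[OF this] show ?thesis
    using chart_subset[OF assms] by (simp add: inf.absorb2)
qed

text \<open>Openness allows derivatives of transition maps to be computed from their values on the
  overlap.\<close>

lemma open_chart_overlap:
  assumes c: "c \<in> A" and d: "d \<in> A"
  shows "open (snd c ` (fst c \<inter> fst d))"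
proof -
  have "openin (subtopology X (fst c)) (fst c \<inter> fst d)"
    using manifold_chart[OF d] unfolding is_chart_def by (intro openin_subtopology_Int2) auto
  then have "openin (top_of_set (snd c ` fst c)) (snd c ` (fst c \<inter> fst d))"
    using manifold_chart[OF c] homeomorphic_imp_open_map unfolding is_chart_def open_map_def by blast
  moreover have "open (snd c ` fst c)"
    using manifold_chart[OF c] unfolding is_chart_def by blast
  ultimately show ?thesis using openin_open_trans by blast
qed

lemma transition_chart: "c \<in> A \<Longrightarrow> p \<in> fst c \<Longrightarrow> transition c d (snd c p) = snd d p"
  by (simp add: transition_def inj_on_chart)

lemma transition_derivative:
  assumes "c \<in> A" "d \<in> A" "p \<in> fst c" "p \<in> fst d"
  shows "(transition c d has_derivative frechet_derivative (transition c d) (at (snd c p))) (at (snd c p))"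
    "frechet_derivative (transition c d) (at (snd c p)) (a *s v)
      = a *s frechet_derivative (transition c d) (at (snd c p)) v"
proof -
  obtain D where D: "(transition c d has_derivative D) (at (snd c p))" "\<forall>a v. D (a *s v) = a *s D v"
  proof -
    have "holomorphic_map_on (transition c d) (snd c ` (fst c \<inter> fst d))"
      using M assms(1,2) by (simp add: complex_manifold_def)
    then show ?thesis
      using that assms(3,4) unfolding holomorphic_map_on_def by blast
  qed
  then have "D = frechet_derivative (transition c d) (at (snd c p))"
    using frechet_derivative_at by blast
  then show "(transition c d has_derivative frechet_derivative (transition c d) (at (snd c p))) (at (snd c p))"
    "frechet_derivative (transition c d) (at (snd c p)) (a *s v)
      = a *s frechet_derivative (transition c d) (at (snd c p)) v"
    using D by auto
qed

text \<open>Chain rule: the composite agrees with \<open>transition c e\<close> on the overlap of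
  \<open>c\<close> and \<open>d\<close>, an open set around the point.\<close>

lemma transition_cocycle:
  assumes "c \<in> A" "d \<in> A" "e \<in> A" "p \<in> fst c" "p \<in> fst d" "p \<in> fst e"
  shows "frechet_derivative (transition c e) (at (snd c p)) v
    = frechet_derivative (transition d e) (at (snd d p)) (frechet_derivative (transition c d) (at (snd c p)) v)"
proof -
  have "((\<lambda>x. transition d e (transition c d x)) has_derivative
      (\<lambda>v. frechet_derivative (transition d e) (at (snd d p)) (frechet_derivative (transition c d) (at (snd c p)) v)))
      (at (snd c p))"
    using transition_derivative(1)[of d e p] transition_chart[of c p d] assms
    by (intro has_derivative_compose[OF transition_derivative(1)]) auto
  then have "(transition c e has_derivative
      (\<lambda>v. frechet_derivative (transition d e) (at (snd d p)) (frechet_derivative (transition c d) (at (snd c p)) v)))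
      (at (snd c p))"
  proof (rule has_derivative_transform_within_open)
    show "open (snd c ` (fst c \<inter> fst d))" using assms by (intro open_chart_overlap)
    show "snd c p \<in> snd c ` (fst c \<inter> fst d)" using assms by blast
    show "transition d e (transition c d x) = transition c e x" if "x \<in> snd c ` (fst c \<inter> fst d)" for x
      using that assms by (auto simp: transition_chart)
  qed
  from frechet_derivative_at[OF this] show ?thesis by metis
qed

lemma transition_self:
  assumes "c \<in> A" "p \<in> fst c"
  shows "frechet_derivative (transition c c) (at (snd c p)) v = v"
proof -
  have "((\<lambda>x. x) has_derivative (\<lambda>v. v)) (at (snd c p))" by simp
  then have "(transition c c has_derivative (\<lambda>v. v)) (at (snd c p))"
  proof (rule has_derivative_transform_within_open)
    show "open (snd c ` (fst c \<inter> fst c))" using assms by (intro open_chart_overlap)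
    show "snd c p \<in> snd c ` (fst c \<inter> fst c)" using assms by blast
    show "x = transition c c x" if "x \<in> snd c ` (fst c \<inter> fst c)" for x
      using that assms by (auto simp: transition_chart)
  qed
  from frechet_derivative_at[OF this] show ?thesis by metis
qed

text \<open>Inverse of \<open>tcoord c\<close> over a fixed base point. The value 0 outside the
  charts at \<open>p\<close> matches the normalisation in \<open>tangent_bundle\<close>.\<close>

definition tangent_lift :: "('a, 'n) chart \<Rightarrow> 'a \<Rightarrow> complex^'n \<Rightarrow> ('a, 'n) chart \<Rightarrow> complex^'n" where
  "tangent_lift c p \<eta> d =
     (if d \<in> A \<and> p \<in> fst d then frechet_derivative (transition c d) (at (snd c p)) \<eta> else 0)"

text \<open>The transformation law between two other charts is the cocycle identity.\<close>

lemma tangent_lift_in_bundle: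
  assumes "c \<in> A" "p \<in> fst c"
  shows "(p, tangent_lift c p \<eta>) \<in> tangent_bundle X A"
proof -
  have "p \<in> topspace X"
    using chart_subset assms by blast
  moreover have "tangent_lift c p \<eta> e = frechet_derivative (transition d e) (at (snd d p)) (tangent_lift c p \<eta> d)"
    if "d \<in> A" "e \<in> A" "p \<in> fst d" "p \<in> fst e" for d e
    using that transition_cocycle[OF assms(1) that(1,2) assms(2) that(3,4)]
    by (simp add: tangent_lift_def)
  moreover have "tangent_lift c p \<eta> d = 0" if "d \<notin> A \<or> p \<notin> fst d" for d
    using that by (auto simp: tangent_lift_def)
  ultimately show ?thesis
    unfolding tangent_bundle_def mem_Collect_eq prod.case by blast
qed

lemma tangent_lift_self: "c \<in> A \<Longrightarrow> p \<in> fst c \<Longrightarrow> tangent_lift c p \<eta> c = \<eta>"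
  by (simp add: tangent_lift_def transition_self)

text \<open>The transformation law with source \<open>c\<close> fixes all components at once;
  injectivity of \<open>tcoord c\<close> rests on this.\<close>

lemma tangent_lift_unique:
  assumes "(p, v) \<in> tangent_bundle X A" "c \<in> A" "p \<in> fst c"
  shows "v = tangent_lift c p (v c)"
proof
  fix d
  have 1: "\<forall>c\<in>A. \<forall>d\<in>A. p \<in> fst c \<longrightarrow> p \<in> fst d \<longrightarrow>
      v d = frechet_derivative (transition c d) (at (snd c p)) (v c)"
    and 2: "\<forall>c. c \<notin> A \<or> p \<notin> fst c \<longrightarrow> v c = 0"
    using assms(1) unfolding tangent_bundle_def mem_Collect_eq prod.case by blast+
  show "v d = tangent_lift c p (v c) d"
  proof (cases "d \<in> A \<and> p \<in> fst d")
    case True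
    then show ?thesis using 1 assms(2,3) unfolding tangent_lift_def by metis
  next
    case False
    then show ?thesis using 2 unfolding tangent_lift_def by metis
  qed
qed

text \<open>Derivatives of holomorphic transitions are complex-linear. This carries the homogeneity
  of \<open>F\<close> into coordinates.\<close>

lemma tangent_lift_scale:
  assumes "c \<in> A" "p \<in> fst c"
  shows "tangent_lift c p (a *s \<eta>) = (\<lambda>d. a *s tangent_lift c p \<eta> d)"
  using assms transition_derivative(2) by (intro ext) (auto simp: tangent_lift_def)

text \<open>Evaluates the \<open>inv_into\<close> hidden in \<open>in_coords\<close>, using that
  \<open>tcoord c\<close> is injective on the bundle over the chart.\<close>

lemma in_coords_eq:
  assumes c: "c \<in> A" and p: "p \<in> fst c"
  shows "in_coords X A F c (snd c p, \<eta>) = F (p, tangent_lift c p \<eta>)"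
proof -
  let ?W = "{w \<in> tangent_bundle X A. fst w \<in> fst c}"
  have "inj_on (tcoord c) ?W"
  proof (rule inj_onI, clarify)
    fix q v q' v'
    assume q: "(q, v) \<in> tangent_bundle X A" "fst (q, v) \<in> fst c"
      and q': "(q', v') \<in> tangent_bundle X A" "fst (q', v') \<in> fst c"
      and eq: "tcoord c (q, v) = tcoord c (q', v')"
    have "q = q'" using inj_onD[OF inj_on_chart[OF c]] eq q q' by (simp add: tcoord_def)
    moreover have "v c = v' c" using eq by (simp add: tcoord_def)
    ultimately show "q = q' \<and> v = v'"
      using tangent_lift_unique[OF q(1) c] tangent_lift_unique[OF q'(1) c] q q' by simp
  qed
  moreover have "(p, tangent_lift c p \<eta>) \<in> ?W"
    using tangent_lift_in_bundle[OF c p] p by simp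
  moreover have "tcoord c (p, tangent_lift c p \<eta>) = (snd c p, \<eta>)"
    by (simp add: tcoord_def tangent_lift_self c p)
  ultimately have "inv_into ?W (tcoord c) (snd c p, \<eta>) = (p, tangent_lift c p \<eta>)"
    using inv_into_f_f[of "tcoord c" ?W "(p, tangent_lift c p \<eta>)"] by simp
  then show ?thesis by (simp add: in_coords_def)
qed

end

section \<open>Passage from the bundle to a chart\<close>

text \<open>The lift of a nonzero \<open>\<eta>\<close> is a nonzero tangent vector, since its
  component in \<open>c\<close> is \<open>\<eta>\<close> itself, and \<open>F\<close> vanishes only
  on zero vectors.\<close>

lemma in_coords_pos:
  assumes F: "complex_finsler_space X A F" and c: "c \<in> A" and p: "p \<in> slit_dom c"
  shows "0 < in_coords X A F c p"
proof -
  have M: "complex_manifold X A" using F by (simp add: complex_finsler_space_def)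
  obtain q \<eta> where q: "p = (snd c q, \<eta>)" "q \<in> fst c" "\<eta> \<noteq> 0"
    using p unfolding slit_dom_def by auto
  let ?v = "tangent_lift A c q \<eta>"
  have v: "(q, ?v) \<in> tangent_bundle X A" by (rule tangent_lift_in_bundle[OF M c q(2)])
  have "?v \<noteq> (\<lambda>c. 0)"
    using tangent_lift_self[OF M c q(2), of \<eta>] q(3) by auto
  then have "F (q, ?v) \<noteq> 0" "0 \<le> F (q, ?v)"
    using F v unfolding complex_finsler_space_def by blast+
  then show ?thesis using in_coords_eq[OF M c q(2), of F \<eta>] q by simp
qed

lemma in_coords_scale:
  assumes F: "complex_finsler_space X A F" and c: "c \<in> A" and p: "(z, \<eta>) \<in> slit_dom c"
  shows "in_coords X A F c (z, a *s \<eta>) = cmod a * in_coords X A F c (z, \<eta>)"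
proof -
  have M: "complex_manifold X A" using F by (simp add: complex_finsler_space_def)
  obtain q where q: "z = snd c q" "q \<in> fst c"
    using p unfolding slit_dom_def by auto
  have "(q, tangent_lift A c q \<eta>) \<in> tangent_bundle X A" by (rule tangent_lift_in_bundle[OF M c q(2)])
  then have "F (q, \<lambda>d. a *s tangent_lift A c q \<eta> d) = cmod a * F (q, tangent_lift A c q \<eta>)"
    using F unfolding complex_finsler_space_def by blast
  then show ?thesis
    by (simp add: q in_coords_eq[OF M c q(2)] tangent_lift_scale[OF M c q(2)])
qed

theorem proposition4p5:
  fixes X :: "'a topology" and A :: "('a, 2) chart set" and F :: "('a, 2) tvec \<Rightarrow> real"
  assumes "complex_berwald_space X A F"
  shows "\<forall>c\<in>A. \<forall>p\<in>slit_dom c. \<forall>j.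
    delta (in_coords X A F c) j (I_inv (in_coords X A F c)) p = 0"
proof (intro ballI allI)
  fix c p j
  assume c: "c \<in> A" and p: "p \<in> slit_dom c"
  have F: "complex_finsler_space X A F"
    using assms by (simp add: complex_berwald_space_def kaehler_finsler_space_def)
  have M: "complex_manifold X A"
    using F by (simp add: complex_finsler_space_def)
  have ex: "\<exists>\<gamma>. \<forall>(z, \<eta>)\<in>slit_dom c. L_conn (in_coords X A F c) i j k (z, \<eta>) = \<gamma> z" for i j k
    using assms c by (simp add: complex_berwald_space_def)
  \<comment> \<open>\<open>axis 1 1\<close> is merely some nonzero fibre vector. Evaluating there
    yields one explicit family in place of a separate existential witness for each triple of
    indices.\<close>
  define \<Gamma> where "\<Gamma> i j k z = L_conn (in_coords X A F c) i j k (z, axis 1 1)" for i j k z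
  have \<Gamma>: "L_conn (in_coords X A F c) i j k q = \<Gamma> i j k (fst q)" if q: "q \<in> slit_dom c" for i j k q
  proof -
    obtain \<gamma> where \<gamma>: "\<forall>(z, \<eta>)\<in>slit_dom c. L_conn (in_coords X A F c) i j k (z, \<eta>) = \<gamma> z"
      using ex by blast
    have "(fst q, axis 1 1) \<in> slit_dom c" "(fst q, snd q) \<in> slit_dom c"
      using q by (auto simp: slit_dom_def axis_eq_0_iff)
    from \<gamma>[rule_format, OF this(1)] \<gamma>[rule_format, OF this(2)]
    show ?thesis by (simp add: \<Gamma>_def split: prod.splits)
  qed
  interpret berwald_domain "in_coords X A F c" "snd c ` fst c" \<Gamma>
  proof
    show "open (snd c ` fst c)"
      using manifold_chart[OF M c] by (simp add: is_chart_def)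
    show "smooth_on (snd c ` fst c \<times> - {0}) (\<lambda>p. (in_coords X A F c p)\<^sup>2)"
      using F c by (simp add: complex_finsler_space_def slit_dom_def)
    show "0 < in_coords X A F c p" if "p \<in> snd c ` fst c \<times> - {0}" for p
      using in_coords_pos[OF F c] that by (simp add: slit_dom_def)
    show "in_coords X A F c (z, a *s \<eta>) = cmod a * in_coords X A F c (z, \<eta>)"
      if "(z, \<eta>) \<in> snd c ` fst c \<times> - {0}" "a \<noteq> 0" for z \<eta> a
      using in_coords_scale[OF F c] that by (simp add: slit_dom_def)
    show "positive_definite (g_low (in_coords X A F c) p)" if "p \<in> snd c ` fst c \<times> - {0}" for p
    proof -
      have "\<forall>p\<in>slit_dom c. positive_definite (g_low (in_coords X A F c) p)"
        using F c by (simp add: complex_finsler_space_def)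
      then show ?thesis using that unfolding slit_dom_def by blast
    qed
    show "L_conn (in_coords X A F c) i j k p = \<Gamma> i j k (fst p)" if "p \<in> snd c ` fst c \<times> - {0}" for i j k p
      using \<Gamma> that by (simp add: slit_dom_def)
  qed
  show "delta (in_coords X A F c) j (I_inv (in_coords X A F c)) p = 0"
    using delta_I_inv p by (simp add: S_def slit_dom_def)
qed

end
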